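(* Let $G=\langle a,b \mid a^{b^2}=aa^b,\ aa^b=a^ba\rangle$. (i) The group $G$ is orderable. Let $\leq$ be a total order on $G$ such that $(G,\leq)$ is an ordered group. (ii) If $S$ is a finite subset of $G$ satisfying $\langle S\rangle=G$ and $|S^2|=3|S|-2$, then $|S|\leq 4$. (iii) Moreover, if $S$ is a finite subset of $G$ satisfying $\langle S\rangle=G$, $|S^2|=3|S|-2$ and $|S|=4$, then there exist $x,c\in G$ with $c>1$ and $c^{x^2}=cc^x=c^xc$ such that either $S=\{x,xc,xc^x,xc^{x^2}\}$ or $S=\{x^{-1},x^{-1}c,x^{-1}c^x,x^{-1}c^{x^2}\}$.
   Context: Groups are written multiplicatively with identity $1$. An ordered group $(G,\leq)$ is a group $G$ with a total order $\leq$ on the set $G$ such that $a\leq b$ implies $xay\leq xby$ for all $a,b,x,y\in G$; $G$ is orderable if such an order exists. For a subset $S$ of $G$, $S^2=\{x_1x_2\mid x_1,x_2\in S\}$ and $\langle S\rangle$ is the subgroup generated by $S$. Notation: $a^b=b^{-1}ab$. *)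

theory Defs
  imports "HOL-Algebra.Algebra"
begin

section \<open>Groups given by generators and relations\<close>

text \<open>
  A letter \<open>(x, True)\<close> stands for the generator \<open>x\<close> and \<open>(x, False)\<close> for its formal inverse.
  The generators are all the elements of the type \<open>'x\<close>. A set \<open>R\<close> of pairs of words \<open>(l, r)\<close>
  is read as the set of defining relations \<open>l = r\<close>.
\<close>

type_synonym 'x word = "('x \<times> bool) list"

definition word_inv :: "'x word \<Rightarrow> 'x word" where
  "word_inv w = rev (map (\<lambda>(x, e). (x, \<not> e)) w)"

definition word_conj :: "'x word \<Rightarrow> 'x word \<Rightarrow> 'x word" where
  "word_conj u v = word_inv v @ u @ v"

text \<open>The least congruence on words that contains \<open>R\<close> and makes formal inverses cancel.\<close>

inductive pres_eq :: "('x word \<times> 'x word) set \<Rightarrow> 'x word \<Rightarrow> 'x word \<Rightarrow> bool"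
  for R :: "('x word \<times> 'x word) set" where
  refl: "pres_eq R w w"
| sym: "pres_eq R v w \<Longrightarrow> pres_eq R w v"
| trans: "pres_eq R u v \<Longrightarrow> pres_eq R v w \<Longrightarrow> pres_eq R u w"
| cancel: "pres_eq R (u @ [(x, e), (x, \<not> e)] @ v) (u @ v)"
| relation: "(l, r) \<in> R \<Longrightarrow> pres_eq R (u @ l @ v) (u @ r @ v)"

definition pres_rel :: "('x word \<times> 'x word) set \<Rightarrow> ('x word \<times> 'x word) set" where
  "pres_rel R = {(v, w). pres_eq R v w}"

definition presented_group :: "('x word \<times> 'x word) set \<Rightarrow> 'x word set monoid" where
  "presented_group R =
     \<lparr> carrier = UNIV // pres_rel R,
       monoid.mult = (\<lambda>A B. \<Union>v\<in>A. \<Union>w\<in>B. pres_rel R `` {v @ w}),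
       one = pres_rel R `` {[]} \<rparr>"

lemma equiv_pres_rel: "equiv UNIV (pres_rel R)"
  by (rule equivI)
     (auto simp: pres_rel_def refl_on_def sym_def trans_def intro: pres_eq.intros)

lemma pres_eq_append_left: "pres_eq R v w \<Longrightarrow> pres_eq R (u @ v) (u @ w)"
proof (induction rule: pres_eq.induct)
  case (cancel u' x e v)
  show ?case using pres_eq.cancel[of R "u @ u'" x e v] by simp
next
  case (relation l r u' v)
  then show ?case using pres_eq.relation[of l r R "u @ u'" v] by simp
qed (blast intro: pres_eq.refl pres_eq.sym pres_eq.trans)+

lemma pres_eq_append_right: "pres_eq R v w \<Longrightarrow> pres_eq R (v @ u) (w @ u)"
proof (induction rule: pres_eq.induct)
  case (cancel u' x e v)
  show ?case using pres_eq.cancel[of R u' x e "v @ u"] by simp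
next
  case (relation l r u' v)
  then show ?case using pres_eq.relation[of l r R u' "v @ u"] by simp
qed (blast intro: pres_eq.refl pres_eq.sym pres_eq.trans)+

lemma pres_eq_append:
  "pres_eq R v v' \<Longrightarrow> pres_eq R w w' \<Longrightarrow> pres_eq R (v @ w) (v' @ w')"
  by (blast intro: pres_eq.trans pres_eq_append_left pres_eq_append_right)

lemma pres_eq_word_inv: "pres_eq R (word_inv w @ w) []"
proof (induction w)
  case Nil
  show ?case by (simp add: word_inv_def pres_eq.refl)
next
  case (Cons a w)
  obtain x e where a: "a = (x, e)" by fastforce
  have "pres_eq R (word_inv (a # w) @ a # w) (word_inv w @ w)"
    using pres_eq.cancel[of R "word_inv w" x "\<not> e" w] by (simp add: a word_inv_def)
  then show ?case using Cons pres_eq.trans by blast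
qed

lemma pres_class_eq_iff: "pres_rel R `` {v} = pres_rel R `` {w} \<longleftrightarrow> pres_eq R v w"
  using eq_equiv_class_iff[OF equiv_pres_rel, of v w R] by (simp add: pres_rel_def)

lemma carrier_presented_group:
  "carrier (presented_group R) = range (\<lambda>w. pres_rel R `` {w})"
  by (auto simp: presented_group_def quotient_def)

lemma one_presented_group: "\<one>\<^bsub>presented_group R\<^esub> = pres_rel R `` {[]}"
  by (simp add: presented_group_def)

lemma mult_presented_group:
  "(pres_rel R `` {v}) \<otimes>\<^bsub>presented_group R\<^esub> (pres_rel R `` {w}) = pres_rel R `` {v @ w}"
proof -
  have "(\<Union>v'\<in>pres_rel R `` {v}. \<Union>w'\<in>pres_rel R `` {w}. pres_rel R `` {v' @ w'})
      = pres_rel R `` {v @ w}"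
  proof (rule UN_equiv_class2[OF equiv_pres_rel equiv_pres_rel])
    show "congruent2 (pres_rel R) (pres_rel R) (\<lambda>v w. pres_rel R `` {v @ w})"
      by (rule congruent2I') (simp add: pres_class_eq_iff, simp add: pres_rel_def pres_eq_append)
  qed auto
  then show ?thesis by (simp add: presented_group_def)
qed

lemma group_presented_group: "group (presented_group R)"
proof (rule groupI)
  fix A assume "A \<in> carrier (presented_group R)"
  then obtain w where w: "A = pres_rel R `` {w}" by (auto simp: carrier_presented_group)
  have "(pres_rel R `` {word_inv w}) \<otimes>\<^bsub>presented_group R\<^esub> A = \<one>\<^bsub>presented_group R\<^esub>"
    by (simp add: w mult_presented_group one_presented_group pres_class_eq_iff pres_eq_word_inv)
  then show "\<exists>B\<in>carrier (presented_group R). B \<otimes>\<^bsub>presented_group R\<^esub> A = \<one>\<^bsub>presented_group R\<^esub>"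
    by (auto simp: carrier_presented_group)
qed (auto simp: carrier_presented_group one_presented_group mult_presented_group)

text \<open>The universal property: evaluation of words in a group in which the relations hold.\<close>

fun eval_word :: "('g, 'm) monoid_scheme \<Rightarrow> ('x \<Rightarrow> 'g) \<Rightarrow> 'x word \<Rightarrow> 'g" where
  "eval_word H f [] = \<one>\<^bsub>H\<^esub>"
| "eval_word H f ((x, e) # w) = (if e then f x else inv\<^bsub>H\<^esub> f x) \<otimes>\<^bsub>H\<^esub> eval_word H f w"

context group
begin

lemma eval_word_closed:
  "range f \<subseteq> carrier G \<Longrightarrow> eval_word G f w \<in> carrier G"
  by (induction w) (auto simp: image_subset_iff)

lemma eval_word_append:
  "range f \<subseteq> carrier G \<Longrightarrow> eval_word G f (v @ w) = eval_word G f v \<otimes> eval_word G f w"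
  by (induction v) (auto simp: eval_word_closed image_subset_iff m_assoc)

lemma eval_word_pres_eq:
  assumes "pres_eq R v w" "range f \<subseteq> carrier G"
    and "\<And>l r. (l, r) \<in> R \<Longrightarrow> eval_word G f l = eval_word G f r"
  shows "eval_word G f v = eval_word G f w"
  using assms(1)
proof (induction rule: pres_eq.induct)
  case (cancel u x e v)
  have "f x \<in> carrier G" using assms(2) by auto
  then have "eval_word G f [(x, e), (x, \<not> e)] = \<one>" by simp
  then show ?case
    using assms(2) eval_word_append[OF assms(2), of "[(x, e), (x, \<not> e)]" v]
    by (simp add: eval_word_append eval_word_closed del: eval_word.simps(2))
next
  case (relation l r u v)
  then show ?case using assms(2,3) by (simp add: eval_word_append)
qed auto

theorem presented_group_universal:
  assumes "range f \<subseteq> carrier G"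
    and "\<And>l r. (l, r) \<in> R \<Longrightarrow> eval_word G f l = eval_word G f r"
  shows "\<exists>h \<in> hom (presented_group R) G. \<forall>w. h (pres_rel R `` {w}) = eval_word G f w"
proof -
  define h where "h A = eval_word G f (SOME w. A = pres_rel R `` {w})" for A
  have h: "h (pres_rel R `` {w}) = eval_word G f w" for w
  proof -
    have "pres_rel R `` {w} = pres_rel R `` {SOME v. pres_rel R `` {w} = pres_rel R `` {v}}"
      by (rule someI_ex) blast
    then have "pres_eq R w (SOME v. pres_rel R `` {w} = pres_rel R `` {v})"
      by (simp only: pres_class_eq_iff)
    from eval_word_pres_eq[OF this assms] show ?thesis by (simp add: h_def)
  qed
  have "h \<in> hom (presented_group R) G"
    using assms(1)
    by (auto simp: hom_def carrier_presented_group mult_presented_group h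
        eval_word_closed eval_word_append)
  with h show ?thesis by blast
qed

end


section \<open>The group \<open>\<langle>a, b | a\<^sup>b\<^sup>b = a a\<^sup>b, a a\<^sup>b = a\<^sup>b a\<rangle>\<close>\<close>

datatype gen = Gen_a | Gen_b

definition G_ab_relations :: "(gen word \<times> gen word) set" where
  "G_ab_relations =
     (let a = [(Gen_a, True)]; b = [(Gen_b, True)] in
      { (word_conj a (b @ b), a @ word_conj a b),
        (a @ word_conj a b, word_conj a b @ a) })"

definition G_ab :: "gen word set monoid" where
  "G_ab = presented_group G_ab_relations"


section \<open>Ordered groups\<close>

text \<open>The relation \<open>le\<close> is the graph of the non-strict order: \<open>(a, b) \<in> le\<close> means \<open>a \<le> b\<close>.\<close>

locale ordered_group = group G for G (structure) +
  fixes le :: "('a \<times> 'a) set"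
  assumes linear_order: "linear_order_on (carrier G) le"
    and mult_mono: "\<lbrakk> (a, b) \<in> le; x \<in> carrier G; y \<in> carrier G \<rbrakk>
      \<Longrightarrow> (x \<otimes> a \<otimes> y, x \<otimes> b \<otimes> y) \<in> le"

definition orderable :: "('a, 'm) monoid_scheme \<Rightarrow> bool" where
  "orderable G \<longleftrightarrow> (\<exists>le. ordered_group G le)"

definition group_conj :: "('a, 'm) monoid_scheme \<Rightarrow> 'a \<Rightarrow> 'a \<Rightarrow> 'a" where
  "group_conj G a b = inv\<^bsub>G\<^esub> b \<otimes>\<^bsub>G\<^esub> a \<otimes>\<^bsub>G\<^esub> b"

end

theory Submission
  imports Defs Complex_Main
begin

text \<open>
  The relations say that \<open>b\<close> acts by conjugation on the subgroup generated by \<open>a\<close> and \<open>a\<^sup>b\<close> as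
  the golden ratio \<open>\<phi>\<close> acts by multiplication on \<open>\<int>[\<phi>]\<close>. So the group embeds into the group of pairs
  \<open>(n, u)\<close> of an integer and a real number with product \<open>(m, u)(n, v) = (m + n, \<phi>\<^sup>n u + v)\<close>; every
  element has a normal form \<open>a\<^sup>i (a\<^sup>b)\<^sup>j b\<^sup>n\<close>, and \<open>\<phi>\<close> is irrational (theorem \<open>G_ab_embedding\<close>). The
  lexicographic order on the pairs is invariant under translations from both sides, which gives
  part (i).

  The size of \<open>S\<^sup>2\<close> does not depend on an order, so parts (ii) and (iii) can be studied in the group of
  pairs with its lexicographic order. The order that the theorem is about decides only which of \<open>c\<close>
  and \<open>c\<^sup>-\<^sup>1\<close> is the positive one; replacing \<open>c\<close> by its inverse reverses the set in question.

  The combinatorial part uses the order and two properties of the group of pairs: among nontrivial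
  elements commuting is transitive, because the pairs act as affine maps \<open>x \<mapsto> \<phi>\<^sup>n x + u\<close> of the line,
  and two nontrivial such maps commute only if they have the same fixed points, infinity included; and
  no nontrivial element is conjugate to its square, because \<open>2\<close> is not a power of \<open>\<phi>\<close>. In every
  ordered group with these properties a nonabelian set \<open>S\<close> with at least four elements has an element
  whose removal leaves a nonabelian set and destroys at least three products (\<open>ex_removable\<close>), and
  nonabelian sets satisfy \<open>|S\<^sup>2| \<ge> 3|S| - 2\<close> (\<open>card_sq_nonabelian\<close>).

  The decisive case is that of four elements \<open>p < q < r < s\<close> with at most ten products. Then no two
  neighbours commute (\<open>adjacent_not_commute\<close>), so the products in
  \<open>p\<^sup>2 < {pq, qp} < q\<^sup>2 < {qr, rq} < r\<^sup>2 < {rs, sr} < s\<^sup>2\<close> are ten different ones and there are no others.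
  The products \<open>pr\<close>, \<open>rp\<close>, \<open>qs\<close> and \<open>sq\<close> have to occur in this list, at places that the order nearly
  determines (\<open>outer_products\<close>). For pairs these equations are linear; they put the four elements into
  one coset with \<open>n = \<plusminus>1\<close> and make their second components \<open>t, t + r, t + \<phi>r, t + \<phi>\<^sup>2r\<close>
  (\<open>golden_four\<close>). Five elements with thirteen products would contain two overlapping quadruples of
  this shape, whose gaps disagree, and removing elements one at a time excludes every larger set
  (\<open>card_sq_ge_five\<close>).
\<close>

section \<open>Products in a bi-ordered group\<close>

text \<open>
  Only the multiplication enters, so the set is literally the same for every order on the group.
\<close>

definition (in times) sq :: "'a set \<Rightarrow> 'a set" where
  "sq S = {x * y | x y. x \<in> S \<and> y \<in> S}"

context times begin

lemma sqI: "x \<in> S \<Longrightarrow> y \<in> S \<Longrightarrow> x * y \<in> sq S"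
  by (auto simp: sq_def)

lemma sqE:
  assumes "z \<in> sq S" obtains x y where "x \<in> S" "y \<in> S" "z = x * y"
  using assms by (auto simp: sq_def)

lemma sq_mono: "S \<subseteq> T \<Longrightarrow> sq S \<subseteq> sq T"
  by (auto simp: sq_def)

lemma finite_sq [simp]: "finite S \<Longrightarrow> finite (sq S)"
  unfolding sq_def by (rule finite_image_set2) auto

definition abelian_set :: "'a set \<Rightarrow> bool" where
  "abelian_set S \<longleftrightarrow> (\<forall>x\<in>S. \<forall>y\<in>S. x * y = y * x)"

end

text \<open>
  Inverses are only asserted to exist. The order and the multiplication are then all the structure
  there is, and reversing either of them gives an instance of the class again.
\<close>

class ordered_group_mult = monoid_mult + linorder +
  assumes ex_left_inverse: "\<exists>y. y * x = 1"
    and mult_strict_mono_left: "x < y \<Longrightarrow> z * x < z * y"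
    and mult_strict_mono_right: "x < y \<Longrightarrow> x * z < y * z"
begin

lemma mult_less_left_iff [simp]: "z * x < z * y \<longleftrightarrow> x < y"
  by (metis less_asym linorder_cases less_irrefl mult_strict_mono_left)

lemma mult_less_right_iff [simp]: "x * z < y * z \<longleftrightarrow> x < y"
  by (metis less_asym linorder_cases less_irrefl mult_strict_mono_right)

lemma mult_eq_left_iff [simp]: "z * x = z * y \<longleftrightarrow> x = y"
  by (metis linorder_cases less_irrefl mult_strict_mono_left)

lemma mult_eq_right_iff [simp]: "x * z = y * z \<longleftrightarrow> x = y"
  by (metis linorder_cases less_irrefl mult_strict_mono_right)

lemma mult_le_left_iff [simp]: "z * x \<le> z * y \<longleftrightarrow> x \<le> y"
  by (metis not_less mult_less_left_iff)

lemma mult_le_right_iff [simp]: "x * z \<le> y * z \<longleftrightarrow> x \<le> y"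
  by (metis not_less mult_less_right_iff)

lemma ex_right_inverse: "\<exists>y. x * y = 1"
  by (metis ex_left_inverse local.mult.assoc local.mult_1_left local.mult_1_right)

lemma square_eq_one_iff: "x * x = 1 \<longleftrightarrow> x = 1"
  by (metis less_trans linorder_cases less_irrefl mult_less_left_iff mult_1_right)

lemma mult_strict_mono_both: "x < y \<Longrightarrow> u \<le> v \<Longrightarrow> x * u < y * v"
  by (meson le_less_trans less_le_trans mult_le_left_iff mult_less_right_iff)

lemma mult_strict_mono_both': "x \<le> y \<Longrightarrow> u < v \<Longrightarrow> x * u < y * v"
  by (meson le_less_trans less_le_trans mult_le_right_iff mult_less_left_iff)

text \<open>
  These two rules express that the centralizer of \<open>x\<close> is closed under quotients, without mentioning
  inverses.
\<close>

lemma commute_cancel_right: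
  assumes "x * p = p * x" "x * (z * p) = (z * p) * x" shows "x * z = z * x"
  by (metis assms mult.assoc mult_eq_right_iff)

lemma commute_cancel_left:
  assumes "x * p = p * x" "x * (p * z) = (p * z) * x" shows "x * z = z * x"
  by (metis assms mult.assoc mult_eq_left_iff)

lemma commute_mult: "x * y = y * x \<Longrightarrow> x * z = z * x \<Longrightarrow> x * (y * z) = (y * z) * x"
  by (metis mult.assoc)

lemma not_in_sq_if_above:
  assumes "\<And>u. u \<in> T \<Longrightarrow> u \<le> y" "y * y < w"
  shows "w \<notin> sq T"
proof
  assume "w \<in> sq T"
  then obtain u v where "u \<in> T" "v \<in> T" "w = u * v" by (rule sqE)
  then have "w \<le> y * y"
    by (metis assms(1) mult_le_left_iff mult_le_right_iff order_trans)
  with assms(2) show False by simp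
qed

lemma card_sq_add_three:
  assumes "finite S" "T \<subseteq> S" "distinct [u, v, w]" "{u, v, w} \<subseteq> sq S - sq T"
  shows "card (sq S) \<ge> card (sq T) + 3"
proof -
  have fT: "finite T" using assms(1,2) finite_subset by blast
  have "card (sq T \<union> {u, v, w}) = card (sq T) + card {u, v, w}"
    using fT assms(4) by (intro card_Un_disjoint) auto
  also have "card {u, v, w} = 3" using assms(3) by auto
  finally have "card (sq T \<union> {u, v, w}) = card (sq T) + 3" .
  moreover have "card (sq T \<union> {u, v, w}) \<le> card (sq S)"
    using assms sq_mono[of T S] by (intro card_mono) auto
  ultimately show ?thesis by simp
qed

text \<open>
  Let \<open>y\<close> be the largest element of \<open>T\<close>. The products \<open>x\<^sup>2\<close>, \<open>xy\<close> and \<open>yx\<close> exceed all products of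
  elements of \<open>T\<close>, so only the case \<open>xy = yx\<close> is left. There the largest element \<open>z\<close> of \<open>T\<close> that does
  not commute with \<open>x\<close> replaces \<open>y\<close>: one of \<open>xz\<close> and \<open>zx\<close> is new.
\<close>

lemma card_sq_insert_max:
  assumes fin: "finite T" and max: "\<And>y. y \<in> T \<Longrightarrow> y < x"
    and t: "t \<in> T" "x * t \<noteq> t * x"
  shows "card (sq (insert x T)) \<ge> card (sq T) + 3"
proof -
  define N where "N = {y \<in> T. x * y \<noteq> y * x}"
  define y where "y = Max T"
  define z where "z = Max N"
  have "N \<noteq> {}" "finite N" using fin t by (auto simp: N_def)
  then have zN: "z \<in> N" and z_max: "\<And>u. u \<in> N \<Longrightarrow> u \<le> z"
    by (auto simp: z_def)
  then have z: "z \<in> T" "x * z \<noteq> z * x" by (auto simp: N_def)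
  have "T \<noteq> {}" using t by auto
  then have y: "y \<in> T" and y_max: "\<And>u. u \<in> T \<Longrightarrow> u \<le> y"
    using fin by (simp_all add: y_def)
  have yx: "y < x" using max y by blast
  have above: "w \<notin> sq T" if "y * y < w" for w
    using y_max that by (rule not_in_sq_if_above)
  have xy: "x * y \<notin> sq T" and yx': "y * x \<notin> sq T" and xx: "x * x \<notin> sq T"
    using yx mult_strict_mono_both[OF yx, of y x] by (auto intro!: above)
  show ?thesis
  proof (cases "x * y = y * x")
    case False
    show ?thesis
      by (rule card_sq_add_three[of _ _ "x * x" "x * y" "y * x"])
        (use fin False xx xy yx' y yx in \<open>auto intro: sqI\<close>)
  next
    case True
    have comm: "x * u = u * x" if "u \<in> T" "z < u" for u
      using that z_max[of u] by (force simp: N_def)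
    \<comment> \<open>If \<open>z x = j l\<close> with factors from \<open>T\<close>, then \<open>j > z\<close> since \<open>l < x\<close>, so \<open>j\<close> commutes with \<open>x\<close>;
      then \<open>l\<close> cannot, as otherwise \<open>z\<close> would. So \<open>l \<le> z\<close> and \<open>z x = j l < x z\<close>. Symmetrically
      \<open>x z < z x\<close> if \<open>x z\<close> is a product of two elements of \<open>T\<close>.\<close>
    have "z * x \<notin> sq T \<or> x * z \<notin> sq T"
    proof (rule ccontr)
      assume "\<not> ?thesis"
      then obtain j l j' l' where
        j: "j \<in> T" "l \<in> T" "z * x = j * l" and j': "l' \<in> T" "j' \<in> T" "x * z = l' * j'"
        by (auto elim!: sqE)
      have "z < j"
      proof (rule ccontr)
        assume "\<not> z < j"
        then have "j * l < z * x" using max[OF j(2)] by (intro mult_strict_mono_both') auto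
        with j(3) show False by simp
      qed
      have "l \<le> z"
      proof (rule ccontr)
        assume "\<not> l \<le> z"
        then have "x * (z * x) = (z * x) * x"
          using comm[OF j(1) \<open>z < j\<close>] comm[OF j(2)] j(3) by (simp add: commute_mult)
        then show False using z(2) by (metis commute_cancel_right)
      qed
      then have 1: "z * x < x * z"
        using j(3) max[OF j(1)] mult_strict_mono_both by simp
      have "z < j'"
      proof (rule ccontr)
        assume "\<not> z < j'"
        then have "l' * j' < x * z" using max[OF j'(1)] by (intro mult_strict_mono_both) auto
        with j'(3) show False by simp
      qed
      have "l' \<le> z"
      proof (rule ccontr)
        assume "\<not> l' \<le> z"
        then have "x * (x * z) = (x * z) * x"
          using comm[OF j'(2) \<open>z < j'\<close>] comm[OF j'(1)] j'(3) by (simp add: commute_mult)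
        then show False using z(2) by (metis commute_cancel_left)
      qed
      then have "x * z < z * x"
        using j'(3) max[OF j'(2)] mult_strict_mono_both' by simp
      with 1 show False by simp
    qed
    then obtain w where w: "w \<notin> sq T" "w = z * x \<or> w = x * z" by blast
    have "w \<noteq> x * x" "w \<noteq> x * y"
      using w(2) z True by auto
    then show ?thesis
      by (intro card_sq_add_three[of _ _ "x * x" "x * y" w])
        (use fin xx xy w y yx z in \<open>auto intro: sqI\<close>)
  qed
qed

text \<open>
  Each new largest element \<open>x\<close> brings \<open>x\<^sup>2\<close> and its product with the previous largest element.
\<close>

lemma card_sq_ge:
  assumes "finite T" "T \<noteq> {}"
  shows "2 * card T \<le> card (sq T) + 1"
  using assms
proof (induction T rule: finite_linorder_max_induct)
  case empty
  then show ?case by simp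
next
  case (insert x T)
  show ?case
  proof (cases "T = {}")
    case True
    then show ?thesis by (auto simp: sq_def)
  next
    case False
    define y where "y = Max T"
    have y: "y \<in> T" and y_max: "\<And>u. u \<in> T \<Longrightarrow> u \<le> y"
      using insert False by (auto simp: y_def)
    have yx: "y < x" using insert y by blast
    have above: "w \<notin> sq T" if "y * y < w" for w
      using y_max that by (rule not_in_sq_if_above)
    have "x * y \<notin> sq T" "x * x \<notin> sq T" "x * y \<noteq> x * x"
      using yx mult_strict_mono_both[OF yx, of y x] by (auto intro!: above)
    then have "card (sq T \<union> {x * y, x * x}) = card (sq T) + 2"
      using insert by (subst card_Un_disjoint) auto
    moreover have "card (sq T \<union> {x * y, x * x}) \<le> card (sq (insert x T))"
      using insert y sq_mono[of T "insert x T"] by (intro card_mono) (auto intro: sqI)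
    moreover have "x \<notin> T" using insert by blast
    ultimately show ?thesis using insert False by simp
  qed
qed

text \<open>
  If \<open>xT = Tx\<close>, conjugation by \<open>x\<close> would be an order preserving permutation of the finite set \<open>T\<close>, hence
  trivial. The least element that does not commute with \<open>x\<close> makes this concrete.
\<close>

lemma card_left_right_translates:
  assumes fin: "finite T" and t: "t \<in> T" "x * t \<noteq> t * x"
  shows "card T + 1 \<le> card ((\<lambda>y. x * y) ` T \<union> (\<lambda>y. y * x) ` T)" (is "_ \<le> card (?L \<union> ?R)")
proof -
  define N where "N = {y \<in> T. x * y \<noteq> y * x}"
  define z where "z = Min N"
  have "N \<noteq> {}" "finite N" using fin t by (auto simp: N_def)
  then have zN: "z \<in> N" and z_min: "\<And>u. u \<in> N \<Longrightarrow> z \<le> u"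
    by (auto simp: z_def)
  then have z: "z \<in> T" "x * z \<noteq> z * x" by (auto simp: N_def)
  have comm: "x * u = u * x" if "u \<in> T" "u < z" for u
    using that z_min[of u] by (force simp: N_def)
  have ne: "?L \<noteq> ?R"
  proof
    assume eq: "?L = ?R"
    show False
    proof (cases "x * z < z * x")
      case True
      obtain u where u: "u \<in> T" "x * z = u * x" using eq z(1) by blast
      with True have "u < z" by simp
      with comm u have "x * z = x * u" by simp
      with \<open>u < z\<close> show False by simp
    next
      case False
      obtain u where u: "u \<in> T" "z * x = x * u" using eq z(1) by blast
      with False z(2) have "x * u < x * z" by simp
      then have "u < z" by simp
      with comm u have "z * x = u * x" by simp
      with \<open>u < z\<close> show False by simp
    qed
  qed
  have cL: "card ?L = card T" and cR: "card ?R = card T"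
    by (auto intro!: card_image inj_onI)
  have "?L \<subset> ?L \<union> ?R"
    using ne cL cR fin by (metis card_subset_eq finite_imageI inf_sup_ord(3) psubsetI sup.absorb_iff1)
  then have "card ?L < card (?L \<union> ?R)" using fin by (intro psubset_card_mono) auto
  with cL show ?thesis by simp
qed

end

section \<open>Ordered groups with transitive commuting\<close>

text \<open>
  The second assumption excludes the Baumslag-Solitar relation \<open>r\<^sup>q = r\<^sup>2\<close>. Under this relation the sets
  \<open>{q, qr, \<dots>, qr\<^sup>k}\<close> of any size would have exactly \<open>3|S| - 2\<close> products.
\<close>

class ct_ordered_group_mult = ordered_group_mult +
  assumes commute_trans: "y \<noteq> 1 \<Longrightarrow> x * y = y * x \<Longrightarrow> y * z = z * y \<Longrightarrow> x * z = z * x"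
    and no_doubling: "q * r = (r * r) * q \<Longrightarrow> r = 1"
begin

text \<open>
  Statements about largest elements and about \<open>a < b < c < d\<close> also hold for smallest elements and for
  \<open>d < c < b < a\<close>.
\<close>

lemma reversed_ct_ordered_group:
  "class.ct_ordered_group_mult (1) (*) (\<lambda>x y. y \<le> x) (\<lambda>x y. y < x)"
  by unfold_locales (auto intro: ex_left_inverse commute_trans no_doubling)

text \<open>
  The same list of products read with the factors exchanged: this halves the case distinctions in
  which \<open>xy\<close> and \<open>yx\<close> play symmetric roles.
\<close>

lemma opposite_ct_ordered_group:
  "class.ct_ordered_group_mult (1) (\<lambda>x y. y * x) (\<le>) (<)"
proof unfold_locales
  fix q r assume *: "r * q = q * (r * r)"
  obtain p where p: "p * q = 1" "q * p = 1"
    by (metis ex_left_inverse ex_right_inverse mult.assoc mult_1_left mult_1_right)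
  have "p * r = r * r * p"
    using * p by (metis mult.assoc mult_1_left mult_1_right)
  then show "r = 1" by (rule no_doubling)
qed (auto simp: mult.assoc intro: ex_right_inverse elim!: commute_trans[rotated] )

lemma card_sq_insert_min:
  assumes "finite T" "\<And>y. y \<in> T \<Longrightarrow> x < y" "t \<in> T" "x * t \<noteq> t * x"
  shows "card (sq (insert x T)) \<ge> card (sq T) + 3"
proof -
  interpret dual: ct_ordered_group_mult 1 "(*)" "\<lambda>x y. y \<le> x" "\<lambda>x y. y < x"
    by (rule reversed_ct_ordered_group)
  show ?thesis using dual.card_sq_insert_max assms by blast
qed

lemma commute_square: "(x * x) * y = y * (x * x) \<Longrightarrow> x * y = y * x"
  by (metis commute_trans mult.assoc mult_1_left mult_1_right square_eq_one_iff)

lemma conj_swap_eq: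
  assumes "p * z = z * q" "z * p = q * z" shows "p = q"
proof -
  \<comment> \<open>Conjugation by \<open>z\<close> exchanges \<open>p\<close> and \<open>q\<close>, so its square fixes \<open>q\<close>.\<close>
  have "(z * z) * q = q * (z * z)" by (metis assms mult.assoc)
  then have "z * q = q * z" by (rule commute_square)
  with assms(1) show ?thesis by simp
qed

text \<open>
  The sets \<open>T\<^sup>2\<close>, \<open>xT \<union> Tx\<close> and \<open>{x\<^sup>2}\<close> are disjoint: an element of \<open>T\<^sup>2\<close> commutes with \<open>t\<close>, an element
  \<open>xy\<close> or \<open>yx\<close> with \<open>y \<in> T\<close> does not, and \<open>x\<^sup>2\<close> does not either, since \<open>x\<close> does not.
\<close>

lemma card_sq_insert_noncommuting:
  assumes fin: "finite T" and ab: "abelian_set T" and t: "t \<in> T" "x * t \<noteq> t * x"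
  shows "card (sq (insert x T)) \<ge> card (sq T) + card ((\<lambda>y. x * y) ` T \<union> (\<lambda>y. y * x) ` T) + 1"
    (is "_ \<ge> card (sq T) + card ?M + 1")
proof -
  have comm: "t * y = y * t" if "y \<in> T" for y using ab t that by (auto simp: abelian_set_def)
  have 1: "sq T \<inter> ?M = {}"
  proof -
    have "t * w = w * t" if "w \<in> sq T" for w
      using that comm by (auto elim!: sqE simp: commute_mult)
    moreover have "t * w \<noteq> w * t" if w: "w \<in> ?M" for w
    proof -
      obtain y where "y \<in> T" "w = x * y \<or> w = y * x" using w by blast
      then show ?thesis
        using comm t(2) commute_cancel_right[of t y x] commute_cancel_left[of t y x] by metis
    qed
    ultimately show ?thesis by blast
  qed
  have 2: "x * x \<notin> sq T"
  proof
    assume "x * x \<in> sq T"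
    then have "(x * x) * t = t * (x * x)" using comm by (auto elim!: sqE simp: commute_mult)
    with t(2) show False by (auto dest: commute_square)
  qed
  have 3: "x * x \<notin> ?M"
    using t ab by (auto simp: abelian_set_def)
  have "card (sq T) + card ?M + 1 = card (insert (x * x) (sq T \<union> ?M))"
    using 1 2 3 fin by (simp add: card_Un_disjoint)
  also have "\<dots> \<le> card (sq (insert x T))"
    using fin sq_mono[of T "insert x T"] by (intro card_mono) (auto intro: sqI)
  finally show ?thesis by simp
qed

text \<open>
  A nontrivial element of an abelian set decides for the whole set whether \<open>x\<close> commutes with it.
\<close>

lemma not_commute_abelian:
  assumes ab: "abelian_set T" and na: "\<not> abelian_set (insert x T)"
    and t: "t \<in> T" "t \<noteq> 1"
  shows "x * t \<noteq> t * x"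
proof
  assume "x * t = t * x"
  then have "x * y = y * x" if "y \<in> T" for y
    using commute_trans[of t x y] ab t that by (auto simp: abelian_set_def)
  with ab na show False by (auto simp: abelian_set_def)
qed

lemma nonabelian_partner:
  assumes "x \<noteq> 1" "\<not> abelian_set T"
  shows "\<exists>t\<in>T. x * t \<noteq> t * x"
proof (rule ccontr)
  assume "\<not> ?thesis"
  then have "y * z = z * y" if "y \<in> T" "z \<in> T" for y z
    using commute_trans[of x y z] assms(1) that by auto
  with assms(2) show False by (auto simp: abelian_set_def)
qed

text \<open>
  If \<open>T\<close> is nonabelian, \<open>x\<close> adds three products to those counted by the induction hypothesis. If \<open>T\<close> is
  abelian, \<open>T\<^sup>2\<close>, \<open>xT \<union> Tx\<close> and \<open>x\<^sup>2\<close> contribute \<open>2|T| - 1\<close>, \<open>|T| + 1\<close> and \<open>1\<close> products.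
\<close>

lemma card_sq_nonabelian_step:
  assumes fin: "finite T" and max: "\<And>y. y \<in> T \<Longrightarrow> y < x" and x: "x \<noteq> 1"
    and na: "\<not> abelian_set (insert x T)"
    and IH: "\<not> abelian_set T \<Longrightarrow> 3 * card T \<le> card (sq T) + 2"
  shows "3 * card (insert x T) \<le> card (sq (insert x T)) + 2"
proof -
  have "x \<notin> T" using max by auto
  then have card: "card (insert x T) = card T + 1" using fin by simp
  show ?thesis
  proof (cases "abelian_set T")
    case False
    then obtain t where "t \<in> T" "x * t \<noteq> t * x"
      using nonabelian_partner x by blast
    then have "card (sq (insert x T)) \<ge> card (sq T) + 3"
      using card_sq_insert_max fin max by blast
    with IH[OF False] card show ?thesis by simp
  next
    case True
    then obtain t where t: "t \<in> T" "x * t \<noteq> t * x"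
      using na by (auto simp: abelian_set_def)
    then have "T \<noteq> {}" by auto
    with card_sq_insert_noncommuting[OF fin True t] card_left_right_translates[OF fin t]
      card_sq_ge[OF fin] card
    show ?thesis by linarith
  qed
qed

text \<open>
  Induction by removing the largest element, or the smallest one if the largest one is \<open>1\<close>.
\<close>

theorem card_sq_nonabelian:
  assumes "finite S" "\<not> abelian_set S"
  shows "3 * card S \<le> card (sq S) + 2"
  using assms
proof (induction S rule: finite_psubset_induct)
  case (psubset S)
  interpret dual: ct_ordered_group_mult 1 "(*)" "\<lambda>x y. y \<le> x" "\<lambda>x y. y < x"
    by (rule reversed_ct_ordered_group)
  have ne: "S \<noteq> {}" using psubset.prems by (auto simp: abelian_set_def)
  have IH: "3 * card (S - {e}) \<le> card (sq (S - {e})) + 2"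
    if "e \<in> S" "\<not> abelian_set (S - {e})" for e
    using psubset.IH[of "S - {e}"] that by blast
  have "Max S \<in> S" "Min S \<in> S" using ne psubset.hyps by auto
  have insert: "insert e (S - {e}) = S" if "e \<in> S" for e using that by blast
  show ?case
  proof (cases "Max S = 1")
    case False
    have "y < Max S" if "y \<in> S - {Max S}" for y
      using that psubset.hyps Max_ge[of S y] by (simp add: order.strict_iff_order)
    from card_sq_nonabelian_step[OF _ this False, of "S - {Max S}", unfolded insert[OF \<open>Max S \<in> S\<close>]]
    show ?thesis using psubset IH[OF \<open>Max S \<in> S\<close>] by blast
  next
    case True
    have "Min S \<noteq> 1"
    proof
      assume "Min S = 1"
      with True have "S \<subseteq> {1}"
        using psubset.hyps Max_ge[of S] Min_le[of S] by (auto intro: order.antisym)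
      then show False using psubset.prems by (auto simp: abelian_set_def)
    qed
    moreover have "Min S < y" if "y \<in> S - {Min S}" for y
      using that psubset.hyps Min_le[of S y] by (auto simp: order.strict_iff_order)
    ultimately show ?thesis
      using dual.card_sq_nonabelian_step[of "S - {Min S}" "Min S", unfolded insert[OF \<open>Min S \<in> S\<close>]]
        psubset IH[OF \<open>Min S \<in> S\<close>] by blast
  qed
qed

text \<open>
  The largest element \<open>x\<close> can be removed unless the rest is abelian. In that case \<open>x\<close> commutes with no
  nontrivial other element, so the rest stays nonabelian when the smallest element is removed instead.
  Three products disappear with it by \<open>card_sq_insert_min\<close>, except possibly if it is \<open>1\<close>; then the
  products \<open>1\<close>, the second smallest element, and \<open>x\<close> disappear.
\<close>

lemma ex_removable_if_max_not_one:
  assumes fin: "finite S" and na: "\<not> abelian_set S" and card: "4 \<le> card S"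
    and x: "x \<in> S" "x \<noteq> 1" and max: "\<And>y. y \<in> S \<Longrightarrow> y \<le> x"
  shows "\<exists>e\<in>S. \<not> abelian_set (S - {e}) \<and> card (sq (S - {e})) + 3 \<le> card (sq S)"
proof -
  have insert: "insert e (S - {e}) = S" if "e \<in> S" for e using that by blast
  show ?thesis
  proof (cases "abelian_set (S - {x})")
    case False
    then obtain t where "t \<in> S - {x}" "x * t \<noteq> t * x"
      using nonabelian_partner x by blast
    then have "card (sq (insert x (S - {x}))) \<ge> card (sq (S - {x})) + 3"
      using fin max by (intro card_sq_insert_max) (auto simp: order.strict_iff_order)
    then show ?thesis using False x insert by auto
  next
    case True
    have nc: "x * t \<noteq> t * x" if "t \<in> S" "t \<noteq> x" "t \<noteq> 1" for t
      using not_commute_abelian[OF True, of x t] insert[OF x(1)] na that by simp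
    define m where "m = Min S"
    have m: "m \<in> S" and min: "\<And>y. y \<in> S \<Longrightarrow> m \<le> y"
      using fin x by (auto simp: m_def intro!: Min_in)
    have mx: "m \<noteq> x"
    proof
      assume "m = x"
      then have "S \<subseteq> {x}" using max min by (auto intro: order.antisym)
      then have "card S \<le> 1" using card_mono[of "{x}" S] by simp
      with card show False by simp
    qed
    have "card (S - {m, x}) \<ge> 2"
      using card fin m x mx by (subst card_Diff_subset) auto
    moreover have "card (S - {m, x}) \<le> 1" if "S - {m, x} \<subseteq> {1}"
      using card_mono[OF _ that] by simp
    ultimately obtain t where t: "t \<in> S - {m, x}" "t \<noteq> 1"
      by fastforce
    then have na_m: "\<not> abelian_set (S - {m})"
      using nc[of t] x mx by (auto simp: abelian_set_def)
    show ?thesis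
    proof (cases "m = 1")
      case False
      then have "x \<in> S - {m}" "m * x \<noteq> x * m" using nc[of m] m mx x by auto
      then have "card (sq (insert m (S - {m}))) \<ge> card (sq (S - {m})) + 3"
        using fin min by (intro card_sq_insert_min) (auto simp: order.strict_iff_order)
      then show ?thesis using na_m m insert by auto
    next
      case True
      have gt1: "1 < y" if "y \<in> S - {1}" for y
        using that min[of y] True by (auto simp: order.strict_iff_order)
      define s where "s = Min (S - {1})"
      \<comment> \<open>Every product of elements greater than \<open>1\<close> exceeds the least of them, so \<open>1\<close> and the
        second smallest element \<open>s\<close> of \<open>S\<close> are products only through the factor \<open>1\<close>.\<close>
      have "S - {1} \<noteq> {}" using t by blast
      then have s: "s \<in> S - {1}" and s_min: "\<And>y. y \<in> S - {1} \<Longrightarrow> s \<le> y"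
        using fin Min_in[of "S - {1}"] by (simp_all add: s_def)
      have "t < x" using max[of t] t by (auto simp: order.strict_iff_order)
      then have sx: "s < x" using s_min[of t] t True by auto
      have big: "y < u * v" "y < v * u" if "y \<le> u" "v \<in> S - {1}" for u v y
        using mult_strict_mono_both'[OF that(1) gt1[OF that(2)]]
          mult_strict_mono_both[OF gt1[OF that(2)] that(1)]  by simp_all
      have "1 \<notin> sq (S - {1})"
        using big(1)[of 1] gt1 by (metis less_imp_le less_irrefl sqE)
      moreover have "s \<notin> sq (S - {1})"
        using big(1)[of s] s_min by (metis less_irrefl sqE)
      moreover have "x \<notin> sq (S - {1})"
      proof
        assume "x \<in> sq (S - {1})"
        then obtain u v where uv: "u \<in> S - {1}" "v \<in> S - {1}" "x = u * v" by (rule sqE)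
        then have "u \<noteq> x" "v \<noteq> x" using big(1)[of u u v] big(2)[of v v u] by auto
        then have "u * v = v * u"
          using uv \<open>abelian_set (S - {x})\<close> unfolding abelian_set_def by blast
        then have "u * x = x * u" using uv(3) by (simp add: commute_mult)
        with nc[of u] uv \<open>u \<noteq> x\<close> show False by simp
      qed
      moreover have "1 * y \<in> sq S" if "y \<in> S" for y using that m True by (intro sqI) auto
      then have "y \<in> sq S" if "y \<in> S" for y using that by simp
      ultimately have "card (sq (S - {1})) + 3 \<le> card (sq S)"
        using fin s x sx m True by (intro card_sq_add_three[of _ _ 1 s x]) auto
      then show ?thesis using na_m m True by auto
    qed
  qed
qed

lemma ex_removable:
  assumes fin: "finite S" and na: "\<not> abelian_set S" and card: "4 \<le> card S"
  shows "\<exists>e\<in>S. \<not> abelian_set (S - {e}) \<and> card (sq (S - {e})) + 3 \<le> card (sq S)"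
proof -
  interpret dual: ct_ordered_group_mult 1 "(*)" "\<lambda>x y. y \<le> x" "\<lambda>x y. y < x"
    by (rule reversed_ct_ordered_group)
  have ne: "S \<noteq> {}" using card by auto
  have M: "Max S \<in> S" "Min S \<in> S" "\<And>y. y \<in> S \<Longrightarrow> y \<le> Max S" "\<And>y. y \<in> S \<Longrightarrow> Min S \<le> y"
    using ne fin by auto
  have "\<not> (Max S = 1 \<and> Min S = 1)"
  proof
    assume "Max S = 1 \<and> Min S = 1"
    then have "S \<subseteq> {1}" using M by (auto intro: order.antisym)
    then show False using na by (auto simp: abelian_set_def)
  qed
  then show ?thesis
    using ex_removable_if_max_not_one[OF assms M(1) _ M(3)] dual.ex_removable_if_max_not_one[OF assms M(2) _ M(4)] by blast
qed

end

section \<open>Four elements with a commuting pair of neighbours\<close>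

context ct_ordered_group_mult begin

lemmas distinct_unfold = distinct.simps list.set insert_iff empty_iff de_Morgan_disj simp_thms
lemmas mem_unfold = insert_iff empty_iff simp_thms

text \<open>
  Lower bounds on \<open>|S\<^sup>2|\<close> for concrete sets come from explicit lists of different products.
\<close>

lemma length_le_card_sq:
  assumes "finite S" "distinct D" "set D \<subseteq> sq S" "length D = n"
  shows "n \<le> card (sq S)"
  using card_mono[OF finite_sq[OF assms(1)] assms(3)] distinct_card[OF assms(2)] assms(4) by simp

lemma sq_eq_list:
  assumes "finite S" "distinct D" "set D \<subseteq> sq S" "card (sq S) \<le> length D"
  shows "sq S = set D"
  using card_seteq[OF finite_sq[OF assms(1)] assms(3)] distinct_card[OF assms(2)] assms(4) by simp

text \<open>
  \<open>P\<^sup>2\<close>, \<open>qP \<union> Pq\<close> and \<open>q\<^sup>2\<close> give at least \<open>5 + 4 + 1\<close> products. With only ten, \<open>P\<close> is a geometric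
  progression with ratio \<open>r\<close>, and two of its elements are moved into \<open>P\<close> when conjugated by \<open>q\<close>. Their
  quotient \<open>r\<close> or \<open>r\<^sup>2\<close> then moves to \<open>r\<close> or \<open>r\<^sup>2\<close>: if the exponents agree, \<open>q\<close> commutes with \<open>r\<close> and
  so with \<open>P\<close>, and otherwise \<open>no_doubling\<close> applies.
\<close>

lemma card_sq_insert_abelian_triple:
  assumes p: "p1 < p2" "p2 < p3" and ab: "abelian_set {p1, p2, p3}"
    and na: "\<not> abelian_set {q, p1, p2, p3}"
  shows "11 \<le> card (sq {q, p1, p2, p3})"
proof (rule ccontr)
  assume few: "\<not> ?thesis"
  interpret opposite: ct_ordered_group_mult 1 "\<lambda>x y. y * x" "(\<le>)" "(<)"
    by (rule opposite_ct_ordered_group)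
  define P where "P = {p1, p2, p3}"
  define L where "L = (\<lambda>y. q * y) ` P"
  define R where "R = (\<lambda>y. y * q) ` P"
  have "p1 \<noteq> p2" "p1 \<noteq> p3" "p2 \<noteq> p3" using p by auto
  then have fin: "finite P" and P3: "card P = 3" by (simp_all add: P_def)
  have "finite L" "finite R" using fin by (auto simp: L_def R_def)
  have LR3: "card L = 3" "card R = 3"
    unfolding L_def R_def using P3 by (auto simp: card_image inj_on_def)
  have nc: "q * t \<noteq> t * q" if "t \<in> P" "t \<noteq> 1" for t
    using not_commute_abelian[OF ab na] that by (auto simp: P_def)
  have comm: "s * t = t * s" if "s \<in> P" "t \<in> P" for s t
    using ab that by (auto simp: P_def abelian_set_def)
  obtain t where t: "t \<in> P" "t \<noteq> 1" using p by (metis P_def insertCI less_irrefl)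
  have "card (sq P) + card (L \<union> R) + 1 \<le> card (sq (insert q P))"
    unfolding L_def R_def using card_sq_insert_noncommuting[OF fin _ t(1) nc[OF t]] ab
    by (simp add: P_def)
  moreover have "card (sq (insert q P)) \<le> 10" using few by (simp add: P_def)
  moreover have "5 \<le> card (sq P)" using card_sq_ge[OF fin] P3 by (auto simp: P_def)
  moreover have "4 \<le> card (L \<union> R)"
    using card_left_right_translates[OF fin t(1) nc[OF t]] P3 by (simp add: L_def R_def)
  ultimately have sqP: "card (sq P) \<le> 5" and LR: "card (L \<union> R) = 4" by linarith+
  \<comment> \<open>Equality everywhere: conjugation by \<open>q\<close> moves two elements of \<open>P\<close> into \<open>P\<close>.\<close>
  have "card (L \<inter> R) = 2"
    using card_Un_Int[OF \<open>finite L\<close> \<open>finite R\<close>] LR LR3 by simp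
  then obtain u v where uv: "u \<in> L \<inter> R" "v \<in> L \<inter> R" "u \<noteq> v"
    by (metis card_2_iff' )
  have "\<exists>i\<in>P. \<exists>k\<in>P. \<exists>j\<in>P. \<exists>l\<in>P. i < k \<and> j < l \<and> q * i = j * q \<and> q * k = l * q"
  proof -
    obtain i j where ij: "i \<in> P" "j \<in> P" "u = q * i" "u = j * q"
      using uv(1) by (auto simp: L_def R_def)
    obtain k l where kl: "k \<in> P" "l \<in> P" "v = q * k" "v = l * q"
      using uv(2) by (auto simp: L_def R_def)
    show ?thesis
    proof (cases "u < v")
      case True
      then have "i < k" "j < l" using ij kl by (metis mult_less_left_iff mult_less_right_iff)+
      then show ?thesis using ij kl by metis
    next
      case False
      then have "v < u" using uv(3) by simp
      then have "k < i" "l < j" using ij kl by (metis mult_less_left_iff mult_less_right_iff)+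
      then show ?thesis using ij kl by metis
    qed
  qed
  then obtain i j k l where P: "i \<in> P" "k \<in> P" "j \<in> P" "l \<in> P"
    and less: "i < k" "j < l" and conj: "q * i = j * q" "q * k = l * q" by blast
  have "sq P = set [p1 * p1, p1 * p2, p2 * p2, p2 * p3, p3 * p3]"
  proof (rule sq_eq_list)
    show "distinct [p1 * p1, p1 * p2, p2 * p2, p2 * p3, p3 * p3]"
    proof -
      have "p1 * p1 < p1 * p2" "p1 * p2 < p2 * p2" "p2 * p2 < p2 * p3" "p2 * p3 < p3 * p3"
        using p by simp_all
      then show ?thesis by (simp only: distinct_unfold) (intro conjI; order)
    qed
  qed (use fin sqP in \<open>auto simp: P_def intro: sqI\<close>)
  moreover have "p1 * p3 \<in> sq P" by (auto simp: P_def intro: sqI)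
  moreover have "p1 * p2 < p1 * p3" "p1 * p3 < p2 * p3" "p1 * p1 < p1 * p2" "p2 * p3 < p3 * p3"
    using p by simp_all
  ultimately have "p1 * p3 \<in> {p1 * p1, p1 * p2, p2 * p2, p2 * p3, p3 * p3}" by simp
  then have p13: "p1 * p3 = p2 * p2"
    using \<open>p1 * p2 < p1 * p3\<close> \<open>p1 * p3 < p2 * p3\<close> \<open>p1 * p1 < p1 * p2\<close> \<open>p2 * p3 < p3 * p3\<close>
    by auto
  \<comment> \<open>The triple is the geometric progression \<open>p\<^sub>1, p\<^sub>1 r, p\<^sub>1 r\<^sup>2\<close>.\<close>
  obtain p1' where "p1 * p1' = 1" using ex_right_inverse by blast
  define r where "r = p1' * p2"
  have p2: "p2 = p1 * r"
    by (simp add: r_def mult.assoc[symmetric] \<open>p1 * p1' = 1\<close>)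
  have "p1 * (r * p1) = p1 * (p1 * r)"
    using comm[of p1 p2] p2 by (simp add: P_def mult.assoc)
  then have rp1: "r * p1 = p1 * r" by simp
  have p3: "p3 = p1 * (r * r)"
    using p13 p2 rp1 by (metis mult.assoc mult_eq_left_iff)
  have "r \<noteq> 1" using p p2 by auto
  have rP: "r * w = w * r" if "w \<in> P" for w
    using that rp1 p2 p3 by (auto simp: P_def mult.assoc) (metis mult.assoc)+
  have step: "k = i * r \<or> k = i * (r * r)" if "i \<in> P" "k \<in> P" "i < k" for i k
  proof -
    have "i = p1 \<and> k = p2 \<or> i = p1 \<and> k = p3 \<or> i = p2 \<and> k = p3"
      using that p by (auto simp: P_def)
    then show ?thesis using p2 p3 by (auto simp: mult.assoc)
  qed
  have "q * r \<noteq> r * q"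
    using nc[OF t] rP[OF t(1)] commute_trans[OF \<open>r \<noteq> 1\<close>] by metis
  moreover have "q * s = s' * q" if "k = i * s" "l = j * s'" for s s'
  proof -
    have "j * (q * s) = j * (s' * q)"
      using conj that by (metis mult.assoc)
    then show ?thesis by simp
  qed
  moreover have "(k = i * r \<or> k = i * (r * r)) \<and> (l = j * r \<or> l = j * (r * r))"
    using step[OF P(1,2) less(1)] step[OF P(3,4) less(2)] by blast
  ultimately have "q * (r * r) = (r * r) * q \<or> q * r = (r * r) * q \<or> q * (r * r) = r * q"
    by blast
  then show False
    using commute_square[of r q] no_doubling[of q r] opposite.no_doubling[of r q]
      \<open>r \<noteq> 1\<close> \<open>q * r \<noteq> r * q\<close> by auto
qed

text \<open>
  The quotient \<open>g = d c\<^sup>-\<^sup>1\<close> commutes with \<open>c\<close>. The two equations give \<open>b = g a\<close>, so \<open>g\<close> commutes with \<open>a\<close>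
  as well, and is trivial since \<open>a\<close> and \<open>c\<close> do not commute.
\<close>

lemma commuting_pairs_conj:
  assumes ab: "a * b = b * a" and cd: "c * d = d * c" and bc: "a * c \<noteq> c * a"
    and "a * c = c * b" "d * b = b * c"
  shows "c = d"
proof -
  obtain c' where c': "c' * c = 1" "c * c' = 1"
    by (metis ex_left_inverse ex_right_inverse mult.assoc mult_1_left mult_1_right)
  define g where "g = d * c'"
  have d: "d = g * c" by (simp add: g_def mult.assoc c')
  have "(g * c) * c = c * (g * c)" using cd d by simp
  then have gc: "g * c = c * g" by (metis mult.assoc mult_eq_right_iff)
  have "g * (c * b) = b * c" using assms d by (metis mult.assoc)
  then have "g * a = b" using assms by (metis mult.assoc mult_eq_right_iff)
  then have "a * (g * a) = (g * a) * a" using ab by simp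
  then have "a * g = g * a" by (metis mult.assoc mult_eq_right_iff)
  then have "g = 1" using gc bc commute_trans by metis
  then show ?thesis using d by simp
qed

lemma four_products_order:
  assumes "a < b" "b < c" "c < d"
  shows "z * a < z * b" "z * b < z * c" "z * c < z * d" "a * z < b * z" "b * z < c * z" "c * z < d * z"
  using assms by simp_all

lemma chain_products:
  assumes "a < b"
  shows "a * a < a * b" "a * a < b * a" "a * b < b * b" "b * a < b * b"
  using assms by simp_all

text \<open>
  Nine products come from equal and neighbouring factors. The products \<open>ac\<close> and \<open>ca\<close> lie between
  \<open>a\<^sup>2\<close> and \<open>bc\<close> and do not commute with \<open>c\<close>, so they can only coincide with \<open>ab\<close> and \<open>ba\<close>, and by
  \<open>conj_swap_eq\<close> not both do. In the same way \<open>bd\<close> or \<open>db\<close> is new above \<open>bc\<close>.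
\<close>

lemma card_sq_inner_pair:
  assumes lt: "a < b" "b < c" "c < d"
    and "a * b \<noteq> b * a" "c * d \<noteq> d * c" "b * c = c * b" "a * c \<noteq> c * a" "b * d \<noteq> d * b"
  shows "11 \<le> card (sq {a, b, c, d})"
proof -
  have "a * c \<noteq> b * a \<or> c * a \<noteq> a * b"
    using conj_swap_eq[of c a b] lt by auto
  then obtain u where u: "u = a * c \<or> u = c * a" "u \<noteq> a * b" "u \<noteq> b * a"
    using lt by force
  have "b * d \<noteq> d * c \<or> d * b \<noteq> c * d"
    using conj_swap_eq[of b d c] lt by auto
  then obtain v where v: "v = b * d \<or> v = d * b" "v \<noteq> c * d" "v \<noteq> d * c"
    using lt by force
  have "a * c < b * c" "b * c < b * d" "a * a < a * c" "a * a < c * a" "b * d < d * d" "d * b < d * d"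
    using lt by simp_all
  moreover have "c * a < b * c" "b * c < d * b"
    using lt by (subst \<open>b * c = c * b\<close>, simp)+
  ultimately have "u < b * c" "a * a < u" "b * c < v" "v < d * d" using u(1) v(1) by auto
  moreover have "u \<noteq> b * b"
  proof
    assume "u = b * b"
    then have "c * u = u * c" using \<open>b * c = c * b\<close> by (metis mult.assoc)
    then show False using u(1) \<open>a * c \<noteq> c * a\<close>
      by (metis commute_cancel_left commute_cancel_right)
  qed
  moreover have "v \<noteq> c * c"
  proof
    assume "v = c * c"
    then have "b * v = v * b" using \<open>b * c = c * b\<close> by (metis mult.assoc)
    then show False using v(1) \<open>b * d \<noteq> d * b\<close>
      by (metis commute_cancel_left commute_cancel_right)
  qed
  ultimately have "distinct [a * a, a * b, b * a, b * b, u, b * c, v, c * c, c * d, d * c, d * d]"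
    using u(2,3) v(2,3) chain_products[OF lt(1)] chain_products[OF lt(2)] chain_products[OF lt(3)]
      \<open>a * b \<noteq> b * a\<close> \<open>c * d \<noteq> d * c\<close>
    by (simp only: distinct_unfold) (intro conjI; order)
  then show ?thesis
    by (rule length_le_card_sq[rotated]) (use u(1) v(1) in \<open>auto intro: sqI\<close>)
qed

lemma card_sq_one_second:
  assumes lt: "a < 1" "1 < c" "c < d" and "a * c \<noteq> c * a" "c * d \<noteq> d * c"
  shows "11 \<le> card (sq {a, 1, c, d})"
proof -
  have "a * a < a" "a < a * c" "a < c * a" "a * c < c" "c * a < c" "c < c * c" "d < d * c" "d < c * d"
    using lt mult_less_left_iff[of a a 1] mult_less_left_iff[of a 1 c] mult_less_right_iff[of 1 a c]
      mult_less_right_iff[of a c 1] mult_less_left_iff[of c a 1] mult_less_left_iff[of c 1 c]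
      mult_less_left_iff[of d 1 c] mult_less_right_iff[of 1 d c] by auto
  moreover have "a * c \<noteq> 1" "c * a \<noteq> 1"
    using assms(4) commute_cancel_right[of c c a] commute_cancel_left[of c c a]
    by (metis mult_1_left mult_1_right)+
  moreover have "c * c \<noteq> d" using assms(5) by (auto simp: mult.assoc)
  ultimately have "distinct [a * a, a, a * c, c * a, 1, c, c * c, d, c * d, d * c, d * d]"
    using lt assms(4,5) chain_products[OF lt(3)]
    by (simp only: distinct_unfold) (intro conjI; order)
  then show ?thesis
    by (rule length_le_card_sq[rotated])
     (use sqI[of a "{a, 1, c, d}" 1] sqI[of 1 "{a, 1, c, d}" 1] sqI[of c "{a, 1, c, d}" 1]
      sqI[of d "{a, 1, c, d}" 1] in \<open>auto intro: sqI\<close>)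
qed

text \<open>
  The ten listed products leave room for no other. So \<open>d\<close>, which is one of them, is \<open>bc\<close> or \<open>cb\<close>, and
  then the place of \<open>bd\<close> or \<open>db\<close> in the list contradicts \<open>no_doubling\<close>.
\<close>

lemma card_sq_one_first:
  assumes lt: "1 < b" "b < c" "c < d" and nc: "b * c \<noteq> c * b" "c * d \<noteq> d * c" "b * d \<noteq> d * b"
  shows "11 \<le> card (sq {1, b, c, d})"
proof (rule ccontr)
  assume "\<not> ?thesis"
  then have few: "card (sq {1, b, c, d}) \<le> 10" by simp
  interpret opposite: ct_ordered_group_mult 1 "\<lambda>x y. y * x" "(\<le>)" "(<)"
    by (rule opposite_ct_ordered_group)
  have less: "b < b * b" "c < b * c" "c < c * b" "d < c * d" "d < d * c"
    using lt mult_less_left_iff[of b 1 b] mult_less_right_iff[of 1 c b] mult_less_left_iff[of c 1 b]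
      mult_less_right_iff[of 1 d c] mult_less_left_iff[of d 1 c]
    by auto
  have neq: "c \<noteq> b * b" "d \<noteq> b * b" "d \<noteq> c * c" using nc by (auto simp: mult.assoc)
  have memb: "x * y \<in> sq {1, b, c, d}" if "x \<in> {1, b, c, d}" "y \<in> {1, b, c, d}" for x y
    using that by (rule sqI)
  have memb1: "x \<in> sq {1, b, c, d}" if "x \<in> {1, b, c, d}" for x
    using memb[of x 1] that by simp
  have eq: "sq {1, b, c, d} = set [1, b, b * b, c, b * c, c * b, c * c, c * d, d * c, d * d]"
  proof (rule sq_eq_list)
    show "distinct [1, b, b * b, c, b * c, c * b, c * c, c * d, d * c, d * d]"
      using lt less neq nc chain_products[OF lt(2)] chain_products[OF lt(3)]
      by (simp only: distinct_unfold) (intro conjI; order)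
  qed (use few memb memb1 in auto)
  have "d \<in> sq {1, b, c, d}" using memb1 by simp
  then have "d \<in> {1, b, b * b, c, b * c, c * b, c * c, c * d, d * c, d * d}" unfolding eq by simp
  moreover have "d < d * d" using lt mult_less_left_iff[of d 1] by auto
  ultimately have "d = b * c \<or> d = c * b" using lt less neq by auto
  then show False
  proof
    assume d: "d = b * c"
    have "b * d \<in> sq {1, b, c, d}" using memb by simp
    then have "b * d \<in> {1, b, b * b, c, b * c, c * b, c * c, c * d, d * c, d * d}"
      unfolding eq by simp
    moreover have "b * c < b * d" "b * d < c * d" "b * d < d * d" "d < b * d"
      using lt mult_less_right_iff[of 1 d b] by auto
    ultimately have "b * d = c * b \<or> b * d = c * c \<or> b * d = d * c"
      using lt less by auto
    moreover have "b * d = b * b * c" "d * c = b * c * c" using d by (simp_all add: mult.assoc)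
    ultimately show False
      using neq lt no_doubling[of c b] by (auto simp: mult.assoc[symmetric])
  next
    assume d: "d = c * b"
    have "d * b \<in> sq {1, b, c, d}" using memb by simp
    then have "d * b \<in> {1, b, b * b, c, b * c, c * b, c * c, c * d, d * c, d * d}"
      unfolding eq by simp
    moreover have "c * b < d * b" "d * b < d * c" "d * b < d * d" "d < d * b"
      using lt mult_less_left_iff[of d 1 b] by auto
    ultimately have "d * b = b * c \<or> d * b = c * c \<or> d * b = c * d"
      using lt less by auto
    moreover have "d * b = c * (b * b)" "c * d = c * (c * b)" using d by (simp_all add: mult.assoc)
    ultimately show False
      using neq lt opposite.no_doubling[of b c] by auto
  qed
qed

text \<open>
  Here \<open>ac\<close> and \<open>ca\<close> are new besides the eight products of equal and neighbouring factors, and the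
  order leaves no place for both \<open>bd\<close> and \<open>db\<close> among these ten.
\<close>

lemma card_sq_two_pairs_not_conj:
  assumes lt: "a < b" "b < c" "c < d" and ab: "a * b = b * a" and cd: "c * d = d * c"
    and nc: "a * c \<noteq> c * a" "b * c \<noteq> c * b" "b * d \<noteq> d * b"
    and ne: "a * c \<noteq> c * b" "c * a \<noteq> b * c"
  shows "11 \<le> card (sq {a, b, c, d})"
proof (rule ccontr)
  assume "\<not> ?thesis"
  then have few: "card (sq {a, b, c, d}) \<le> 10" by simp
  note ord = four_products_order[OF lt]
  note chain = chain_products[OF lt(1)] chain_products[OF lt(2)] chain_products[OF lt(3)]
  have "a * c \<noteq> b * b" "c * a \<noteq> b * b"
    using ab nc(1) commute_cancel_left[of a a c] commute_cancel_right[of a a c]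
    by (metis mult.assoc)+
  then have "distinct [a * a, a * b, b * b, b * c, c * b, a * c, c * a, c * c, c * d, d * d]"
    using nc(1,2) ne chain ord[of a] ord[of c] ord[of b] ab
    by (simp only: distinct_unfold) (intro conjI; order)
  from sq_eq_list[OF _ this, of "{a, b, c, d}"] few
  have eq: "sq {a, b, c, d} = {a * a, a * b, b * b, b * c, c * b, a * c, c * a, c * c, c * d, d * d}"
    by (auto intro: sqI)
  have ncc: "b * d \<noteq> c * c" "d * b \<noteq> c * c"
    using cd nc(3) commute_cancel_left[of d d b] commute_cancel_right[of d d b]
    by (metis mult.assoc)+
  have "b * d \<in> sq {a, b, c, d}" by (auto intro: sqI)
  then have 1: "b * d = c * b \<or> b * d = c * a"
    unfolding eq using ncc ord[of a] ord[of b] ord[of c] ord[of d] ab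
    by (simp only: mem_unfold) (elim disjE; (blast | (rule FalseE, order)))
  have "d * b \<in> sq {a, b, c, d}" by (auto intro: sqI)
  then have 2: "d * b = b * c \<or> d * b = a * c"
    unfolding eq using ncc cd ord[of a] ord[of b] ord[of c] ord[of d] ab
    by (simp only: mem_unfold) (elim disjE; (blast | (rule FalseE, order)))
  have 3: "\<not> (b * d = c * b \<and> d * b = b * c)"
    using conj_swap_eq[of c b d] lt by auto
  show False
    using 1 2 3 ord[of a] ord[of b] ord[of c] ord[of d] by (elim disjE; (blast | order))
qed

text \<open>
  Unless the previous lemma or its reversal applies, an equation between a product of \<open>a, c\<close> and one of
  \<open>b, c\<close> holds, and so does one between a product of \<open>b, d\<close> and one of \<open>b, c\<close>. Two of the four combinations
  contradict the order, the other two are \<open>commuting_pairs_conj\<close> and its opposite.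
\<close>

lemma card_sq_two_pairs:
  assumes lt: "a < b" "b < c" "c < d" and ab: "a * b = b * a" and cd: "c * d = d * c"
    and nc: "a * c \<noteq> c * a" "b * c \<noteq> c * b" "b * d \<noteq> d * b"
  shows "11 \<le> card (sq {a, b, c, d})"
proof -
  interpret dual: ct_ordered_group_mult 1 "(*)" "\<lambda>x y. y \<le> x" "\<lambda>x y. y < x"
    by (rule reversed_ct_ordered_group)
  interpret opposite: ct_ordered_group_mult 1 "\<lambda>x y. y * x" "(\<le>)" "(<)"
    by (rule opposite_ct_ordered_group)
  note ord = four_products_order[OF lt]
  have perm: "{d, c, b, a} = {a, b, c, d}" by blast
  consider "a * c \<noteq> c * b \<and> c * a \<noteq> b * c" | "d * b \<noteq> b * c \<and> b * d \<noteq> c * b"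
    | "a * c = c * b" "d * b = b * c" | "a * c = c * b" "b * d = c * b"
    | "c * a = b * c" "d * b = b * c" | "c * a = b * c" "b * d = c * b" by blast
  then show ?thesis
  proof cases
    case 1
    then show ?thesis using card_sq_two_pairs_not_conj[OF assms] by blast
  next
    case 2
    then show ?thesis
      using dual.card_sq_two_pairs_not_conj[OF lt(3,2,1) cd[symmetric] ab[symmetric]
          nc(3)[symmetric] nc(2)[symmetric] nc(1)[symmetric]] unfolding perm by blast
  next
    case 3
    then show ?thesis using commuting_pairs_conj[OF ab cd nc(1)] lt by simp
  next
    case 4
    then have False using ord[of b] ord[of c] by order
    then show ?thesis ..
  next
    case 5
    then have False using ord[of b] ord[of a] ord[of d] by order
    then show ?thesis ..
  next
    case 6
    then show ?thesis using opposite.commuting_pairs_conj[OF ab[symmetric] cd[symmetric] nc(1)[symmetric]] lt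
      by simp
  qed
qed

text \<open>
  The nine products of equal and neighbouring factors and \<open>ca\<close> are all there is. Locating first
  \<open>bd\<close> and then \<open>ad\<close> or \<open>db\<close> in this list makes \<open>c\<close> or \<open>d\<close> commute with \<open>a\<close>, or \<open>b = c\<close>.
\<close>

lemma card_sq_lower_pair_conj:
  assumes lt: "a < b" "b < c" "c < d" and ab: "a * b = b * a"
    and nc: "a * c \<noteq> c * a" "b * c \<noteq> c * b" "c * d \<noteq> d * c" "b * d \<noteq> d * b" "a * d \<noteq> d * a"
    and conj: "a * c = c * b"
  shows "11 \<le> card (sq {a, b, c, d})"
proof (rule ccontr)
  assume "\<not> ?thesis"
  then have few: "card (sq {a, b, c, d}) \<le> 10" by simp
  note ord = four_products_order[OF lt]
  note chain = chain_products[OF lt(1)] chain_products[OF lt(2)] chain_products[OF lt(3)]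
  have "c * a \<noteq> b * c" using conj_swap_eq[of a c b] conj lt by auto
  moreover have "c * a \<noteq> b * b"
    using ab nc(1) commute_cancel_right[of a a c] by (metis mult.assoc)
  ultimately have "distinct [a * a, a * b, b * b, b * c, c * b, c * a, c * c, c * d, d * c, d * d]"
    using nc chain ord[of a] ord[of c] ord[of b] ab
    by (simp only: distinct_unfold) (intro conjI; order)
  from sq_eq_list[OF _ this, of "{a, b, c, d}"] few
  have eq: "sq {a, b, c, d} = {a * a, a * b, b * b, b * c, c * b, c * a, c * c, c * d, d * c, d * d}"
    by (auto intro: sqI)
  have "b * d \<in> sq {a, b, c, d}" by (auto intro: sqI)
  then consider "b * d = c * c" | "b * d = d * c"
    unfolding eq using conj ab ord[of a] ord[of b] ord[of c] ord[of d]
    by (simp only: mem_unfold) (elim disjE; (blast | (rule FalseE, order)))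
  then show False
  proof cases
    case 1
    have "a * d \<in> sq {a, b, c, d}" by (auto intro: sqI)
    then have "a * d = b * c"
      unfolding eq using 1 conj ab ord[of a] ord[of b] ord[of c] ord[of d]
      by (simp only: mem_unfold) (elim disjE; (blast | (rule FalseE, order)))
    then have "b * (b * c) = a * (c * c)" using 1 ab by (metis mult.assoc)
    then have "b * b = a * c" by (metis mult.assoc mult_eq_right_iff)
    then have "a * (a * c) = (a * c) * a" using ab by (metis mult.assoc)
    then show False using nc(1) by (metis commute_cancel_left)
  next
    case 2
    have "d * b \<in> sq {a, b, c, d}" by (auto intro: sqI)
    then consider "d * b = b * c" | "d * b = c * c" | "d * b = c * d"
      unfolding eq using conj ab ord[of a] ord[of b] ord[of c] ord[of d]
      by (simp only: mem_unfold) (elim disjE; (blast | (rule FalseE, order)))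
    then show False
    proof cases
      case 1
      have "b * (b * c) = (d * a) * c" using 1 2 conj by (metis mult.assoc)
      then have "b * b = d * a" by (metis mult.assoc mult_eq_right_iff)
      then have "a * (d * a) = (d * a) * a" using ab by (metis mult.assoc)
      then show False using nc(5) by (metis commute_cancel_right)
    next
      case 3
      then show False using 2 conj_swap_eq[of b d c] lt by simp
    next
      case cc: 2
      obtain c' where c': "c' * c = 1" using ex_left_inverse by blast
      \<comment> \<open>\<open>c\<close> conjugates the commuting elements \<open>b, a\<close> into \<open>a, e\<close>, so \<open>e\<close> commutes with \<open>a\<close>. The
        remaining equations give \<open>c e = b a\<close>, so \<open>c\<close> would commute with \<open>a\<close> too.\<close>
      define e where "e = c * a * c'"
      have ca: "c * a = e * c" by (simp add: e_def mult.assoc c')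
      have "(e * a) * c = (a * e) * c"
        using ca conj ab by (metis mult.assoc)
      then have "a * e = e * a" by simp
      have "b * (c * c) = d * (a * c)" using cc 2 conj by (metis mult.assoc)
      then have "b * c = d * a" by (metis mult.assoc mult_eq_right_iff)
      then have "c * (c * a) = b * a * c" using cc ab conj by (metis mult.assoc)
      then have "c * e = b * a" using ca by (metis mult.assoc mult_eq_right_iff)
      then have "a * (c * e) = (c * e) * a" using ab by (metis mult.assoc)
      then show False using \<open>a * e = e * a\<close> nc(1) by (metis commute_cancel_right)
    qed
  qed
qed

text \<open>
  If neither \<open>ac = cb\<close> nor \<open>ca = bc\<close>, both \<open>ac\<close> and \<open>ca\<close> are new, and eleven products are visible. The
  two remaining cases are opposite to each other.
\<close>

lemma card_sq_lower_pair:
  assumes lt: "a < b" "b < c" "c < d" and ab: "a * b = b * a"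
    and nc: "a * c \<noteq> c * a" "b * c \<noteq> c * b" "c * d \<noteq> d * c" "b * d \<noteq> d * b" "a * d \<noteq> d * a"
  shows "11 \<le> card (sq {a, b, c, d})"
proof -
  interpret opposite: ct_ordered_group_mult 1 "\<lambda>x y. y * x" "(\<le>)" "(<)"
    by (rule opposite_ct_ordered_group)
  have sq_opposite: "opposite.sq S = sq S" for S
    by (auto simp: opposite.sq_def sq_def)
  consider "a * c = c * b" | "c * a = b * c" | "a * c \<noteq> c * b" "c * a \<noteq> b * c" by blast
  then show ?thesis
  proof cases
    case 1
    then show ?thesis using card_sq_lower_pair_conj assms by blast
  next
    case 2
    then show ?thesis using opposite.card_sq_lower_pair_conj[of a b c d] assms
      unfolding sq_opposite by metis
  next
    case 3
    note ord = four_products_order[OF lt]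
    note chain = chain_products[OF lt(1)] chain_products[OF lt(2)] chain_products[OF lt(3)]
    have "a * c \<noteq> b * b" "c * a \<noteq> b * b"
      using ab nc(1) commute_cancel_left[of a a c] commute_cancel_right[of a a c]
      by (metis mult.assoc)+
    then have "distinct [a * a, a * b, b * b, b * c, c * b, a * c, c * a, c * c, c * d, d * c, d * d]"
      using nc 3 chain ord[of a] ord[of c] ord[of b] ab
      by (simp only: distinct_unfold) (intro conjI; order)
    then show ?thesis
      by (rule length_le_card_sq[rotated]) (auto intro: sqI)
  qed
qed

end

section \<open>Four elements with at most ten products\<close>

context ct_ordered_group_mult begin

text \<open>
  No three of the elements commute pairwise, by \<open>card_sq_insert_abelian_triple\<close>. Hence none of them is
  \<open>1\<close>, and the commuting pairs are disjoint. This leaves the four patterns of a commuting neighbouring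
  pair that the preceding lemmas, up to reversal, exclude.
\<close>

theorem adjacent_not_commute:
  assumes lt: "a < b" "b < c" "c < d" and na: "\<not> abelian_set {a, b, c, d}"
    and few: "card (sq {a, b, c, d}) \<le> 10"
  shows "a * b \<noteq> b * a" "b * c \<noteq> c * b" "c * d \<noteq> d * c"
proof -
  interpret dual: ct_ordered_group_mult 1 "(*)" "\<lambda>x y. y \<le> x" "\<lambda>x y. y < x"
    by (rule reversed_ct_ordered_group)
  have perm: "{d, c, b, a} = {a, b, c, d}" by blast
  have triple: "\<not> (p * q = q * p \<and> p * r = r * p \<and> q * r = r * q)"
    if "p < q" "q < r" "insert s {p, q, r} = {a, b, c, d}" for p q r s
    using card_sq_insert_abelian_triple[OF that(1,2), of s] na few that(3)
    by (auto simp: abelian_set_def)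
  have abc: "\<not> (a * b = b * a \<and> a * c = c * a \<and> b * c = c * b)"
    using triple[of a b c d] lt by (auto simp: insert_commute)
  have abd: "\<not> (a * b = b * a \<and> a * d = d * a \<and> b * d = d * b)"
    using triple[of a b d c] lt by (auto simp: insert_commute)
  have acd: "\<not> (a * c = c * a \<and> a * d = d * a \<and> c * d = d * c)"
    using triple[of a c d b] lt by (auto simp: insert_commute)
  have bcd: "\<not> (b * c = c * b \<and> b * d = d * b \<and> c * d = d * c)"
    using triple[of b c d a] lt by (auto simp: insert_commute)
  \<comment> \<open>If \<open>1\<close> were one of the four elements, no two of the other three would commute, and the
    lemmas on sets containing \<open>1\<close> would give eleven products.\<close>
  have a1: "a \<noteq> 1"
    using card_sq_one_first[of b c d] lt few abc abd acd by auto
  have b1: "b \<noteq> 1"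
    using card_sq_one_second[of a c d] lt few abc bcd by auto
  have c1: "c \<noteq> 1"
    using dual.card_sq_one_second[of d b a] lt few abc bcd by (auto simp: insert_commute)
  have d1: "d \<noteq> 1"
    using dual.card_sq_one_first[of c b a] lt few abd acd bcd by (auto simp: insert_commute)
  have trans: "x * z = z * x" if "y \<noteq> 1" "x * y = y * x" "y * z = z * y" for x y z
    using commute_trans that by blast
  show 1: "a * b \<noteq> b * a"
  proof
    assume ab: "a * b = b * a"
    have nc: "a * c \<noteq> c * a" "b * c \<noteq> c * b" "a * d \<noteq> d * a" "b * d \<noteq> d * b"
      using ab abc abd trans[OF a1, of b c] trans[OF b1, of a c] trans[OF a1, of b d] trans[OF b1, of a d]
      by metis+
    show False
    proof (cases "c * d = d * c")
      case True
      then show False using card_sq_two_pairs[OF lt ab] nc few by simp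
    next
      case False
      then show False using card_sq_lower_pair[OF lt ab] nc few by simp
    qed
  qed
  show 2: "c * d \<noteq> d * c"
  proof
    assume cd: "c * d = d * c"
    have nc: "a * c \<noteq> c * a" "b * c \<noteq> c * b" "a * d \<noteq> d * a" "b * d \<noteq> d * b"
      using cd acd bcd trans[OF c1, of a d] trans[OF d1, of a c] trans[OF c1, of b d] trans[OF d1, of b c]
      by metis+
    show False
      using dual.card_sq_lower_pair[OF lt(3,2,1) cd[symmetric] nc(4)[symmetric] nc(2)[symmetric]
          1[symmetric] nc(1)[symmetric] nc(3)[symmetric]] few
      unfolding perm by simp
  qed
  show "b * c \<noteq> c * b"
  proof
    assume bc: "b * c = c * b"
    have "a * c \<noteq> c * a" "b * d \<noteq> d * b"
      using bc 1 2 trans[OF c1, of a b] trans[OF b1, of c d] by metis+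
    then show False using card_sq_inner_pair[OF lt 1 2 bc] few by simp
  qed
qed

text \<open>
  The excluded combinations are those where conjugation by one element would exchange two others, and
  \<open>xz = zx = y\<^sup>2\<close>, which makes \<open>y\<close> commute with \<open>x\<close>.
\<close>

lemma outer_products:
  assumes lt: "a < b" "b < c" "c < d" and na: "\<not> abelian_set {a, b, c, d}"
    and few: "card (sq {a, b, c, d}) \<le> 10"
  shows sq_eq_chain: "sq {a, b, c, d} =
        {a * a, a * b, b * a, b * b, b * c, c * b, c * c, c * d, d * c, d * d}"
    and "(a * c, c * a) \<in> {b * a, b * b, c * b} \<times> {a * b, b * b, b * c} -
           {(b * a, a * b), (b * b, b * b), (c * b, b * c)}"
    and "(b * d, d * b) \<in> {c * b, c * c, d * c} \<times> {b * c, c * c, c * d} -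
           {(c * b, b * c), (c * c, c * c), (d * c, c * d)}"
proof -
  note nc = adjacent_not_commute[OF assms]
  note ord = four_products_order[OF lt]
  note chain = chain_products[OF lt(1)] chain_products[OF lt(2)] chain_products[OF lt(3)]
  have "distinct [a * a, a * b, b * a, b * b, b * c, c * b, c * c, c * d, d * c, d * d]"
    using nc chain by (simp only: distinct_unfold) (intro conjI; order)
  from sq_eq_list[OF _ this, of "{a, b, c, d}"] few
  show eq: "sq {a, b, c, d} =
      {a * a, a * b, b * a, b * b, b * c, c * b, c * c, c * d, d * c, d * d}"
    by (auto intro: sqI)
  have "a * c \<in> sq {a, b, c, d}" by (auto intro: sqI)
  then have ac: "a * c \<in> {b * a, b * b, c * b}"
    unfolding eq using chain ord[of a] ord[of b] ord[of c] ord[of d]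
    by (simp only: mem_unfold) (elim disjE; (blast | (rule FalseE, order)))
  have "c * a \<in> sq {a, b, c, d}" by (auto intro: sqI)
  then have ca: "c * a \<in> {a * b, b * b, b * c}"
    unfolding eq using chain ord[of a] ord[of b] ord[of c] ord[of d]
    by (simp only: mem_unfold) (elim disjE; (blast | (rule FalseE, order)))
  have "b * d \<in> sq {a, b, c, d}" by (auto intro: sqI)
  then have bd: "b * d \<in> {c * b, c * c, d * c}"
    unfolding eq using chain ord[of a] ord[of b] ord[of c] ord[of d]
    by (simp only: mem_unfold) (elim disjE; (blast | (rule FalseE, order)))
  have "d * b \<in> sq {a, b, c, d}" by (auto intro: sqI)
  then have db: "d * b \<in> {b * c, c * c, c * d}"
    unfolding eq using chain ord[of a] ord[of b] ord[of c] ord[of d]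
    by (simp only: mem_unfold) (elim disjE; (blast | (rule FalseE, order)))
  have diag: "\<not> (x * z = y * x \<and> z * x = x * y)" "\<not> (x * z = z * y \<and> z * x = y * z)"
    "\<not> (x * z = y * y \<and> z * x = y * y)" if "x < y" "y < z" "x * y \<noteq> y * x" for x y z
  proof -
    show "\<not> (x * z = y * x \<and> z * x = x * y)"
      using conj_swap_eq[of z x y] that by auto
    show "\<not> (x * z = z * y \<and> z * x = y * z)"
      using conj_swap_eq[of x z y] that by auto
    show "\<not> (x * z = y * y \<and> z * x = y * y)"
    proof
      assume *: "x * z = y * y \<and> z * x = y * y"
      then have "(y * y) * x = x * (y * y)" by (metis mult.assoc)
      then show False using commute_square that(3) by metis
    qed
  qed
  show "(a * c, c * a) \<in> {b * a, b * b, c * b} \<times> {a * b, b * b, b * c} -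
           {(b * a, a * b), (b * b, b * b), (c * b, b * c)}"
    using ac ca diag[OF lt(1,2) nc(1)] by blast
  show "(b * d, d * b) \<in> {c * b, c * c, d * c} \<times> {b * c, c * c, c * d} -
           {(c * b, b * c), (c * c, c * c), (d * c, c * d)}"
    using bd db diag[OF lt(2,3) nc(2)] by blast
qed

end

section \<open>The golden ratio and the group of affine maps\<close>

definition phi :: real where "phi = (1 + sqrt 5) / 2"

lemma phi_square: "phi * phi = phi + 1"
  by (simp add: phi_def field_simps)

lemma phi_bounds: "8 / 5 < phi" "phi < 17 / 10"
proof -
  have "11 / 5 < sqrt 5" by (rule real_less_rsqrt) (simp add: power2_eq_square)
  then show "8 / 5 < phi" by (simp add: phi_def)
  have "sqrt 5 < 12 / 5" by (rule real_less_lsqrt) (simp_all add: power2_eq_square)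
  then show "phi < 17 / 10" by (simp add: phi_def)
qed

lemma phi_pos [simp]: "0 < phi" "phi \<noteq> 0"
  using phi_bounds by linarith+

lemma phi_powi_strict_mono: "m < n \<Longrightarrow> phi powi m < phi powi n"
  using phi_bounds by (intro power_int_strict_increasing) auto

lemma phi_powi_inj: "phi powi m = phi powi n \<longleftrightarrow> m = n"
  using phi_powi_strict_mono[of m n] phi_powi_strict_mono[of n m] by (cases m n rule: linorder_cases) auto

lemma phi_powi_eq_one: "phi powi n = 1 \<longleftrightarrow> n = 0"
  using phi_powi_inj[of n 0] by simp

lemma phi_powi_neq_two: "phi powi n \<noteq> 2"
proof (cases "n \<le> 1")
  case True
  then have "phi powi n \<le> phi powi 1" using phi_bounds by (intro power_int_increasing) auto
  with phi_bounds show ?thesis by simp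
next
  case False
  then have "phi powi 2 \<le> phi powi n" using phi_bounds by (intro power_int_increasing) auto
  moreover have "phi powi 2 = phi + 1" using phi_square by (simp add: power2_eq_square)
  ultimately show ?thesis using phi_bounds by simp
qed

lemma phi_powi_neq_half: "phi powi n \<noteq> 1 / 2"
proof
  assume "phi powi n = 1 / 2"
  then have "phi powi (- n) = 2" by (simp only: power_int_minus) simp
  then show False using phi_powi_neq_two by blast
qed

text \<open>
  The other root of the quadratic equation is negative.
\<close>

lemma golden_ratio_unique:
  fixes x :: real assumes "0 < x" "x * x = x + 1" shows "x = phi"
proof -
  have "(x - phi) * (x + phi - 1) = 0"
    using assms(2) phi_square by (simp add: algebra_simps)
  then show ?thesis using assms(1) phi_bounds by auto
qed

text \<open>
  \<open>Aff n u\<close> stands for the affine map \<open>x \<mapsto> \<phi>\<^sup>n x + u\<close>; in a product the left factor acts first.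
\<close>

datatype aff = Aff (expo: int) (shift: real)

instantiation aff :: "{one, times, linorder}"
begin

definition one_aff :: aff where "1 = Aff 0 0"

definition times_aff :: "aff \<Rightarrow> aff \<Rightarrow> aff" where
  "x * y = Aff (expo x + expo y) (phi powi expo y * shift x + shift y)"

definition less_eq_aff :: "aff \<Rightarrow> aff \<Rightarrow> bool" where
  "x \<le> y \<longleftrightarrow> expo x < expo y \<or> expo x = expo y \<and> shift x \<le> shift y"

definition less_aff :: "aff \<Rightarrow> aff \<Rightarrow> bool" where
  "x < y \<longleftrightarrow> expo x < expo y \<or> expo x = expo y \<and> shift x < shift y"

instance
  by standard (auto simp: less_eq_aff_def less_aff_def aff.expand)

end

lemma Aff_mult [simp]: "Aff m u * Aff n v = Aff (m + n) (phi powi n * u + v)"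
  by (simp add: times_aff_def)

lemma Aff_less [simp]: "Aff m u < Aff n v \<longleftrightarrow> m < n \<or> m = n \<and> u < v"
  by (simp add: less_aff_def)

lemma expo_mult [simp]: "expo (x * y) = expo x + expo y"
  by (simp add: times_aff_def)

text \<open>
  For nontrivial elements this says that the two affine maps have the same fixed points.
\<close>

lemma Aff_commute_iff:
  "Aff m u * Aff n v = Aff n v * Aff m u \<longleftrightarrow> (phi powi n - 1) * u = (phi powi m - 1) * v"
  by (auto simp: algebra_simps)

instance aff :: ct_ordered_group_mult
proof
  fix x y z :: aff
  obtain m u where x: "x = Aff m u" by (cases x)
  obtain n v where y: "y = Aff n v" by (cases y)
  obtain k w where z: "z = Aff k w" by (cases z)
  show "x * y * z = x * (y * z)"
    by (simp add: x y z power_int_add algebra_simps)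
  show "1 * x = x" "x * 1 = x" by (simp_all add: x one_aff_def)
  show "\<exists>y. y * x = 1"
    by (rule exI[of _ "Aff (- m) (- (phi powi (- m) * u))"])
       (simp add: x one_aff_def power_int_minus)
  show "z * x < z * y" if "x < y" using that by (auto simp: x y z)
  show "x * z < y * z" if "x < y" using that by (auto simp: x y z)
  show "x * z = z * x" if "y \<noteq> 1" "x * y = y * x" "y * z = z * y"
  proof -
    define p q r where "p = phi powi m - 1" and "q = phi powi n - 1" and "r = phi powi k - 1"
    have 1: "q * u = p * v" and 2: "r * v = q * w"
      using that(2,3) unfolding x y z Aff_commute_iff p_def q_def r_def by simp_all
    have "q \<noteq> 0 \<or> v \<noteq> 0" using that(1) by (auto simp: y one_aff_def q_def phi_powi_eq_one)
    moreover have "q * (r * u) = q * (p * w)"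
    proof -
      have "q * (r * u) = r * (q * u)" by simp
      also have "\<dots> = p * (r * v)" by (simp only: 1) simp
      also have "\<dots> = q * (p * w)" by (simp only: 2) simp
      finally show ?thesis .
    qed
    moreover have "v * (r * u) = v * (p * w)"
    proof -
      have "v * (r * u) = u * (r * v)" by simp
      also have "\<dots> = w * (q * u)" by (simp only: 2) simp
      also have "\<dots> = v * (p * w)" by (simp only: 1) simp
      finally show ?thesis .
    qed
    ultimately have "r * u = p * w" by auto
    then show ?thesis unfolding x z Aff_commute_iff p_def r_def .
  qed
  show "y = 1" if "x * y = y * y * x"
  proof -
    have "n = 0" using that by (simp add: x y)
    moreover have "u + v = phi powi m * (v + v) + u" using that \<open>n = 0\<close> by (simp add: x y)
    then have "v * (1 - 2 * phi powi m) = 0" by (simp add: algebra_simps)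
    then have "v = 0" using phi_powi_neq_half[of m] by (auto simp: field_simps)
    ultimately show ?thesis by (simp add: y one_aff_def)
  qed
qed

text \<open>
  The six combinations are pairs of linear equations for the gaps \<open>g = b - a\<close> and \<open>h = c - a\<close>. Being
  solvable with \<open>g > 0\<close> forces \<open>L = 2\<close>, \<open>L = 1/2\<close>, or the golden equation for \<open>L\<close> or for \<open>1/L\<close>.
\<close>

lemma golden_triple:
  fixes L a b c :: real
  assumes "a < b" "b < c" and L: "0 < L" "L \<noteq> 2" "L \<noteq> 1 / 2"
    and mem: "(L * a + c, L * c + a) \<in>
      {L * b + a, L * b + b, L * c + b} \<times> {L * a + b, L * b + b, L * b + c} -
      {(L * b + a, L * a + b), (L * b + b, L * b + b), (L * c + b, L * b + c)}"
  shows "L * L = L + 1 \<and> (c - a = L * (b - a) \<or> c - a = L * L * (b - a)) \<or>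
    L * L + L = 1 \<and> (b - a = L * (c - a) \<or> b - a = L * L * (c - a))"
proof -
  define g h where "g = b - a" and "h = c - a"
  have b: "b = a + g" and c: "c = a + h" by (simp_all add: g_def h_def)
  have pos: "0 < g" "0 < h" using assms by (auto simp: g_def h_def)
  have "(h = L * g \<and> L * h = L * g + g) \<or> (h = L * g \<and> L * h = L * g + h) \<or>
    (h = L * g + g \<and> L * h = g) \<or> (h = L * g + g \<and> L * h = L * g + h) \<or>
    (h = L * h + g \<and> L * h = g) \<or> (h = L * h + g \<and> L * h = L * g + g)"
  proof -
    have "(L * a + c = L * b + a \<and> L * c + a = L * b + b) \<or>
      (L * a + c = L * b + a \<and> L * c + a = L * b + c) \<or>
      (L * a + c = L * b + b \<and> L * c + a = L * a + b) \<or>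
      (L * a + c = L * b + b \<and> L * c + a = L * b + c) \<or>
      (L * a + c = L * c + b \<and> L * c + a = L * a + b) \<or>
      (L * a + c = L * c + b \<and> L * c + a = L * b + b)"
      using mem by auto
    then show ?thesis unfolding b c by (simp add: algebra_simps)
  qed
  then consider "h = L * g" "L * h = L * g + g" | "h = L * g" "L * h = L * g + h" |
    "h = L * g + g" "L * h = g" | "h = L * g + g" "L * h = L * g + h" |
    "h = L * h + g" "L * h = g" | "h = L * h + g" "L * h = L * g + g" by blast
  then have "L * L = L + 1 \<and> (h = L * g \<or> h = L * L * g) \<or>
    L * L + L = 1 \<and> (g = L * h \<or> g = L * L * h)"
  proof cases
    case 1
    then have "g * (L * L - L - 1) = 0" by (simp add: algebra_simps)
    then show ?thesis using pos 1 by simp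
  next
    case 2
    then have "h * (L - 2) = 0" by (simp add: algebra_simps)
    with pos L show ?thesis by simp
  next
    case 3
    then have "g * (L * L + L - 1) = 0" by (simp add: algebra_simps)
    with pos 3 show ?thesis by simp
  next
    case 4
    then have "g * (L * L - L - 1) = 0" by (simp add: algebra_simps)
    with pos have "L * L = L + 1" by simp
    with 4 show ?thesis by (simp add: distrib_right)
  next
    case 5
    then have "h * (2 * L - 1) = 0" by (simp add: algebra_simps)
    with pos L show ?thesis by simp
  next
    case 6
    then have "h = L * g + 2 * g" by simp
    with 6 have "g * (L * L + L - 1) = 0" by (simp add: algebra_simps)
    with pos have LL: "L * L + L = 1" by simp
    have "L * L * h = L * (L * g + g)" by (simp add: mult.assoc flip: 6(2))
    also have "\<dots> = (L * L + L) * g" by (simp add: algebra_simps)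
    finally show ?thesis using LL by simp
  qed
  then show ?thesis by (simp add: g_def h_def)
qed

text \<open>
  The assumptions on the triples leave four positions of \<open>c\<close> and \<open>d\<close>, expressed through the first gap
  \<open>g\<close>, its multiple \<open>p = L g\<close> and \<open>q = L a\<close>. In three of them \<open>L a + d\<close> or \<open>L d + a\<close> misses the list,
  which the estimate \<open>8/5 < p/g < 17/10\<close> is sharp enough to show.
\<close>

lemma golden_quadruple:
  fixes L a b c d :: real
  assumes lt: "a < b" and L: "0 < L" "L * L = L + 1"
    and abc: "c - a = L * (b - a) \<or> c - a = L * L * (b - a)"
    and bcd: "d - b = L * (c - b) \<or> d - b = L * L * (c - b)"
    and ad: "L * a + d \<in> {L * a + a, L * a + b, L * b + a, L * b + b, L * b + c, L * c + b, L * c + c,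
      L * c + d, L * d + c, L * d + d}"
    and da: "L * d + a \<in> {L * a + a, L * a + b, L * b + a, L * b + b, L * b + c, L * c + b, L * c + c,
      L * c + d, L * d + c, L * d + d}"
  shows "c = a + L * (b - a) \<and> d = a + L * L * (b - a)"
proof -
  have "L = phi" using golden_ratio_unique L by blast
  define g where "g = b - a"
  define p where "p = L * g"
  define q where "q = L * a"
  have g: "0 < g" "b = a + g" using lt by (simp_all add: g_def)
  have p: "8 * g < 5 * p" "10 * p < 17 * g"
    using phi_bounds g \<open>L = phi\<close> by (simp_all add: p_def mult.commute)
  have Lp: "L * p = p + g" "L * L * g = p + g"
    using L(2) by (simp_all add: p_def mult.assoc[symmetric] distrib_right)
  have Lb: "L * b = q + p" by (simp add: g p_def q_def algebra_simps)
  have L2: "L * L * x = L * x + x" for x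
    using L(2) by (simp add: distrib_right)
  consider "c = a + p" "d = a + p + g" | "c = a + p" "d = a + 2 * g"
    | "c = a + p + g" "d = a + p + 2 * g" | "c = a + p + g" "d = a + 2 * p + 2 * g"
  proof -
    have "c - a = p \<or> c - a = p + g"
      using abc unfolding g_def[symmetric] Lp(2) p_def[symmetric] .
    then have "c = a + p \<or> c = a + p + g" by auto
    then have "L * c = q + p + g \<and> c = a + p \<or> L * c = q + 2 * p + g \<and> c = a + p + g"
      using Lp(1) by (auto simp: q_def distrib_left p_def[symmetric])
    moreover have "d = b + L * c - L * b \<or> d = b + L * c + c - L * b - b"
      using bcd L2[of "c - b"] by (auto simp: right_diff_distrib)
    ultimately show thesis using that Lb g(2) by argo
  qed
  then show ?thesis
  proof cases
    case 1
    then show ?thesis using Lp unfolding g_def[symmetric] p_def[symmetric] by simp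
  next
    case 2
    then have "L * c = q + p + g" "L * d = q + 2 * p"
      using Lp by (simp_all add: q_def p_def algebra_simps)
    with 2 ad Lb g p show ?thesis unfolding q_def[symmetric] by auto
  next
    case 3
    then have "L * c = q + 2 * p + g" "L * d = q + 3 * p + g"
      using Lp by (simp_all add: q_def p_def algebra_simps)
    with 3 ad Lb g p show ?thesis unfolding q_def[symmetric] by auto
  next
    case 4
    then have "L * c = q + 2 * p + g" "L * d = q + 4 * p + 2 * g"
      using Lp by (simp_all add: q_def p_def algebra_simps)
    with 4 da Lb g p show ?thesis unfolding q_def[symmetric] by auto
  qed
qed

lemma Aff_not_commute_expo:
  assumes "Aff n u * Aff n v \<noteq> Aff n v * Aff n u" shows "n \<noteq> 0"
  using assms by auto

lemma Aff_same_expo_commute: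
  "n \<noteq> 0 \<Longrightarrow> Aff n u * Aff n v = Aff n v * Aff n u \<longleftrightarrow> u = v"
  unfolding Aff_commute_iff by (simp add: phi_powi_eq_one)

text \<open>
  Each of the six combinations determines two linear equations for the exponents, and these force them
  to be equal.
\<close>

lemma expo_triple_eq:
  assumes "(x * z, z * x) \<in> {y * x, y * y, z * y} \<times> {x * y, y * y, y * z} -
    {(y * x, x * y), (y * y, y * y), (z * y, y * z)}"
  shows "expo x = expo (y :: aff) \<and> expo y = expo z"
proof -
  have "(x * z = y * x \<and> z * x = y * y) \<or> (x * z = y * x \<and> z * x = y * z) \<or>
    (x * z = y * y \<and> z * x = x * y) \<or> (x * z = y * y \<and> z * x = y * z) \<or>
    (x * z = z * y \<and> z * x = x * y) \<or> (x * z = z * y \<and> z * x = y * y)"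
    using assms by auto
  then show ?thesis
    by (elim disjE conjE) (drule arg_cong[of _ _ expo], drule arg_cong[of _ _ expo], simp)+
qed

text \<open>
  The exponents agree by \<open>expo_triple_eq\<close>, and are nonzero since neighbours do not commute. With
  \<open>L = \<phi>\<^sup>n\<close> the second component of a product is \<open>L u + v\<close>, and \<open>golden_triple\<close> gives
  \<open>L = \<phi>\<close> or \<open>L = 1/\<phi>\<close>.
\<close>

theorem golden_four:
  fixes a b c d :: aff
  assumes lt: "a < b" "b < c" "c < d" and na: "\<not> abelian_set {a, b, c, d}"
    and few: "card (sq {a, b, c, d}) \<le> 10"
  shows "\<exists>n t r. (n = 1 \<or> n = - 1) \<and> 0 < r \<and> a = Aff n t \<and> b = Aff n (t + r) \<and>
    c = Aff n (t + phi * r) \<and> d = Aff n (t + phi * phi * r)"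
proof -
  note outer = outer_products[OF assms]
  note nc = adjacent_not_commute[OF assms]
  define n where "n = expo a"
  have "expo a = n" "expo b = n" "expo c = n" "expo d = n"
    using expo_triple_eq[OF outer(2)] expo_triple_eq[OF outer(3)] by (simp_all add: n_def)
  then obtain s t u v where abcd: "a = Aff n s" "b = Aff n t" "c = Aff n u" "d = Aff n v"
    by (metis aff.exhaust_sel)
  have stuv: "s < t" "t < u" "u < v" using lt by (simp_all add: abcd)
  have "n \<noteq> 0" using nc(1) abcd Aff_not_commute_expo by blast
  define L where "L = phi powi n"
  have mult: "Aff n x * Aff n y = Aff (n + n) (L * x + y)" for x y by (simp add: L_def)
  have L: "0 < L" "L \<noteq> 2" "L \<noteq> 1 / 2"
    using phi_powi_neq_two phi_powi_neq_half by (simp_all add: L_def)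
  \<comment> \<open>The second components of the ten products, for multiplier \<open>l\<close>.\<close>
  define W where "W l = {l * s + s, l * s + t, l * t + s, l * t + t, l * t + u, l * u + t, l * u + u,
      l * u + v, l * v + u, l * v + v}" for l :: real
  have ad: "L * s + v \<in> W L"
  proof -
    have "a * d \<in> sq {a, b, c, d}" by (auto intro: sqI)
    then show ?thesis unfolding outer(1) unfolding abcd mult W_def by simp
  qed
  have da: "L * v + s \<in> W L"
  proof -
    have "d * a \<in> sq {a, b, c, d}" by (auto intro: sqI)
    then show ?thesis unfolding outer(1) unfolding abcd mult W_def by simp
  qed
  have abc: "L * L = L + 1 \<and> (u - s = L * (t - s) \<or> u - s = L * L * (t - s)) \<or>
    L * L + L = 1 \<and> (t - s = L * (u - s) \<or> t - s = L * L * (u - s))"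
    by (rule golden_triple) (use outer(2) stuv L in \<open>simp_all add: abcd L_def\<close>)
  have bcd: "L * L = L + 1 \<and> (v - t = L * (u - t) \<or> v - t = L * L * (u - t)) \<or>
    L * L + L = 1 \<and> (u - t = L * (v - t) \<or> u - t = L * L * (v - t))"
    by (rule golden_triple) (use outer(3) stuv L in \<open>simp_all add: abcd L_def\<close>)
  have excl: "\<not> (L * L = L + 1 \<and> L * L + L = 1)" using L(1) by auto
  show ?thesis
  proof (cases "L * L = L + 1")
    case True
    then have "phi powi n = phi powi 1" using golden_ratio_unique[of L] L by (simp add: L_def)
    then have "n = 1" "L = phi" unfolding phi_powi_inj by (simp_all add: L_def)
    moreover have "u = s + L * (t - s) \<and> v = s + L * L * (t - s)"
      by (rule golden_quadruple[OF stuv(1) L(1) True _ _ ad[unfolded W_def] da[unfolded W_def]])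
        (use abc bcd excl True in blast)+
    ultimately show ?thesis
      using abcd stuv by (intro exI[of _ n] exI[of _ s] exI[of _ "t - s"]) simp
  next
    case False
    then have LL: "L * L + L = 1" using abc by blast
    define M where "M = 1 / L"
    have M: "0 < M" "M * L = 1" using L by (simp_all add: M_def)
    have M_L: "M * (L * x) = x" for x using M(2) by (simp add: mult.assoc[symmetric])
    have "M * M * (L * L + L) = M * M" using LL by simp
    then have MM: "M * M = M + 1" using M(2) M_L by (simp add: distrib_left mult.assoc)
    \<comment> \<open>Scaling by \<open>M = 1/L\<close> turns \<open>L y + x\<close> into \<open>M x + y\<close>: the factors change places and the list
      of ten products is symmetric, so the first case applies to \<open>M\<close>.\<close>
    have W: "M * x + y \<in> W M" if "L * y + x \<in> W L" for x y
    proof -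
      have "M * (L * y + x) \<in> (*) M ` W L" using that by blast
      then show ?thesis by (auto simp: W_def distrib_left M_L add.commute)
    qed
    have "M = phi" using golden_ratio_unique M(1) MM by blast
    then have "phi powi (- n) = phi powi 1" by (simp add: power_int_minus M_def L_def inverse_eq_divide)
    then have "n = - 1" unfolding phi_powi_inj by simp
    have inv: "y = M * x \<or> y = M * M * x" if "x = L * y \<or> x = L * L * y" for x y
      using that by (auto simp only: mult.assoc M_L)
    have "u = s + M * (t - s) \<and> v = s + M * M * (t - s)"
      by (rule golden_quadruple[OF stuv(1) M(1) MM _ _ W[OF da, unfolded W_def] W[OF ad, unfolded W_def]])
        (use abc bcd inv False in blast)+
    then show ?thesis
      using abcd stuv \<open>n = - 1\<close> \<open>M = phi\<close> by (intro exI[of _ n] exI[of _ s] exI[of _ "t - s"]) simp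
  qed
qed

section \<open>Five and more elements\<close>

lemma card_Suc_insert_min:
  fixes S :: "'a :: linorder set"
  assumes "card S = Suc n"
  shows "\<exists>x T. S = insert x T \<and> card T = n \<and> (\<forall>y\<in>T. x < y)"
proof (intro exI conjI)
  have S: "finite S" "S \<noteq> {}" using assms card.infinite by fastforce+
  then show "S = insert (Min S) (S - {Min S})" by (simp add: insert_absorb)
  show "card (S - {Min S}) = n" using S assms by simp
  show "\<forall>y\<in>S - {Min S}. Min S < y" using S by (auto simp: less_le)
qed

lemma card_four_sorted:
  fixes S :: "'a :: linorder set"
  assumes "card S = 4"
  shows "\<exists>a b c d. a < b \<and> b < c \<and> c < d \<and> S = {a, b, c, d}"
proof -
  from assms obtain a A where 1: "S = insert a A" "card A = 3" "\<forall>y\<in>A. a < y"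
    using card_Suc_insert_min[of S 3] by auto
  then obtain b B where 2: "A = insert b B" "card B = 2" "\<forall>y\<in>B. b < y"
    using card_Suc_insert_min[of A 2] by auto
  then obtain c C where 3: "B = insert c C" "card C = 1" "\<forall>y\<in>C. c < y"
    using card_Suc_insert_min[of B 1] by auto
  then obtain d where "C = {d}" by (auto simp: card_Suc_eq)
  with 1 2 3 show ?thesis by auto
qed

text \<open>
  Removing an element as in \<open>ex_removable\<close> reduces to five elements with at most thirteen products,
  four of which form a golden quadruple. The fifth lies in the same coset, where no two elements
  commute, so both the largest and the smallest element can be removed, leaving golden quadruples.
\<close>

theorem card_sq_ge_five:
  fixes S :: "aff set"
  assumes "finite S" "\<not> abelian_set S" "5 \<le> card S"
  shows "3 * card S \<le> card (sq S) + 1"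
  using assms
proof (induction "card S" arbitrary: S rule: less_induct)
  case less
  obtain e where e: "e \<in> S" "\<not> abelian_set (S - {e})" "card (sq (S - {e})) + 3 \<le> card (sq S)"
    using ex_removable[OF less.prems(1,2)] less.prems(3) by auto
  have card: "card S = card (S - {e}) + 1"
    using e(1) less.prems(1) by (metis Suc_eq_plus1 card_Suc_Diff1)
  show ?case
  proof (cases "5 \<le> card (S - {e})")
    case True
    then have "3 * card (S - {e}) \<le> card (sq (S - {e})) + 1"
      using less.hyps[of "S - {e}"] less.prems(1) e(2) card by simp
    then show ?thesis using e(3) card by linarith
  next
    case False
    then have four: "card (S - {e}) = 4" using less.prems(3) card by simp
    show ?thesis
    proof (rule ccontr)
      assume few: "\<not> ?thesis"
      then have sqS: "card (sq S) \<le> 13" and sqT: "card (sq (S - {e})) \<le> 10"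
        using four card e(3) by simp_all
      obtain a b c d where T: "a < b" "b < c" "c < d" "S - {e} = {a, b, c, d}"
        using card_four_sorted[OF four] by blast
      then obtain n t r where n: "n = 1 \<or> n = - 1"
        and abcd: "a = Aff n t" "b = Aff n (t + r)" "c = Aff n (t + phi * r)"
          "d = Aff n (t + phi * phi * r)"
        using golden_four[OF T(1-3)] e(2) sqT by (metis (no_types, lifting))
      have S: "S = insert e {a, b, c, d}" using T(4) e(1) by blast
      \<comment> \<open>Outside the coset of the other four, \<open>e\<close> would contribute four products \<open>e y\<close> in a coset
        without products of those four.\<close>
      have "expo e = n"
      proof (rule ccontr)
        assume en: "expo e \<noteq> n"
        define T where "T = {a, b, c, d}"
        have expoT: "expo y = n" if "y \<in> T" for y using that abcd by (auto simp: T_def)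
        have "card ((*) e ` T) = 4"
          using four T(4) by (subst card_image) (auto simp: T_def inj_on_def)
        moreover have "sq T \<inter> (*) e ` T = {}"
        proof -
          have "expo y = n + n" if "y \<in> sq T" for y using that expoT by (auto elim!: sqE)
          moreover have "expo y = expo e + n" if "y \<in> (*) e ` T" for y using that expoT by auto
          ultimately show ?thesis using en by fastforce
        qed
        moreover have "10 \<le> card (sq T)"
          using card_sq_nonabelian[of T] e(2) four T(4) by (simp add: T_def)
        ultimately have "14 \<le> card (sq T \<union> (*) e ` T)"
          by (subst card_Un_disjoint) (auto simp: T_def)
        also have "\<dots> \<le> card (sq S)"
          using less.prems(1) sq_mono[of T S] by (intro card_mono) (auto simp: S T_def intro: sqI)
        finally show False using sqS by simp
      qed
      then have expo: "expo x = n" if "x \<in> S" for x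
        using that abcd by (auto simp: S)
      have nc: "x * y \<noteq> y * x" if "x \<in> S" "y \<in> S" "x \<noteq> y" for x y
        using that expo[of x] expo[of y] n Aff_same_expo_commute[of n "shift x" "shift y"]
        by (metis aff.collapse one_neq_zero neg_equal_0_iff_equal)
      have "card S = Suc 4" using four card by simp
      then obtain x1 A where 1: "S = insert x1 A" "card A = 4" "\<forall>y\<in>A. x1 < y"
        using card_Suc_insert_min by blast
      then obtain x2 x3 x4 x5 where 2: "x2 < x3" "x3 < x4" "x4 < x5" "A = {x2, x3, x4, x5}"
        using card_four_sorted by blast
      have x12: "x1 < x2" using 1 2 by blast
      have S5: "S = {x1, x2, x3, x4, x5}" using 1 2 by simp
      have "card (sq {x1, x2, x3, x4}) + 3 \<le> card (sq (insert x5 {x1, x2, x3, x4}))"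
        using x12 2 nc[of x5 x4] by (intro card_sq_insert_max[of _ _ x4]) (auto simp: S5)
      then have "card (sq {x1, x2, x3, x4}) \<le> 10"
        using sqS by (simp add: S5 insert_commute)
      moreover have "\<not> abelian_set {x1, x2, x3, x4}"
        using nc[of x1 x2] x12 by (auto simp: S5 abelian_set_def)
      ultimately obtain m u q where left: "x1 = Aff m u" "x2 = Aff m (u + q)"
        "x3 = Aff m (u + phi * q)" "x4 = Aff m (u + phi * phi * q)" "0 < q"
        using golden_four[OF x12 2(1,2)] by blast
      have "card (sq {x2, x3, x4, x5}) + 3 \<le> card (sq (insert x1 {x2, x3, x4, x5}))"
        using x12 2 nc[of x1 x2] by (intro card_sq_insert_min[of _ _ x2]) (auto simp: S5)
      then have "card (sq {x2, x3, x4, x5}) \<le> 10"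
        using sqS by (simp add: S5)
      moreover have "\<not> abelian_set {x2, x3, x4, x5}"
        using nc[of x2 x3] 2 by (auto simp: S5 abelian_set_def)
      ultimately obtain m' u' q' where right: "x2 = Aff m' u'" "x3 = Aff m' (u' + q')"
        "x4 = Aff m' (u' + phi * q')"
        using golden_four[OF 2(1,2,3)] by blast
      \<comment> \<open>The quadruples have gaps \<open>q, q/\<phi>, q\<close> and \<open>q', q'/\<phi>, q'\<close>. Overlapping in three elements they
        would give \<open>q' = q/\<phi>\<close> and \<open>q = q'/\<phi>\<close>.\<close>
      have q': "q' = phi * q - q" and q: "phi * phi * q = q + phi * q'"
        using left right by simp_all
      have "phi * q' = phi * phi * q - phi * q"
        unfolding q' by (simp add: algebra_simps)
      then have "phi * q = q" using q by simp
      then show False using left(5) phi_bounds by simp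
    qed
  qed
qed

theorem small_square_imp_golden:
  fixes S :: "aff set"
  assumes "finite S" "\<not> abelian_set S" "card S \<ge> 4" "card (sq S) \<le> 3 * card S - 2"
  shows "card S = 4"
    and "\<exists>n t r. (n = 1 \<or> n = - 1) \<and> r \<noteq> 0 \<and>
      S = {Aff n t, Aff n (t + r), Aff n (t + phi * r), Aff n (t + phi * phi * r)}"
proof -
  show four: "card S = 4" using card_sq_ge_five[OF assms(1,2)] assms(3,4) by linarith
  then obtain a b c d where T: "a < b" "b < c" "c < d" "S = {a, b, c, d}"
    using card_four_sorted by blast
  have "card (sq {a, b, c, d}) \<le> 10" using assms(4) four T(4) by simp
  then show "\<exists>n t r. (n = 1 \<or> n = - 1) \<and> r \<noteq> 0 \<and>
      S = {Aff n t, Aff n (t + r), Aff n (t + phi * r), Aff n (t + phi * phi * r)}"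
    using golden_four[OF T(1-3)] assms(2) unfolding T(4) by (metis less_irrefl)
qed

section \<open>The embedding of the presented group\<close>

definition aff_group :: "aff monoid" where
  "aff_group = \<lparr>carrier = UNIV, monoid.mult = (*), one = 1\<rparr>"

lemma aff_group_simps [simp]:
  "carrier aff_group = UNIV" "x \<otimes>\<^bsub>aff_group\<^esub> y = x * y" "\<one>\<^bsub>aff_group\<^esub> = 1"
  by (simp_all add: aff_group_def)

interpretation aff: group aff_group
  by (rule groupI) (use ex_left_inverse in \<open>auto simp: mult.assoc\<close>)

lemma inv_aff [simp]: "inv\<^bsub>aff_group\<^esub> (Aff n u) = Aff (- n) (- (phi powi (- n) * u))"
  by (rule aff.inv_equality) (simp_all add: one_aff_def power_int_minus)

lemma int_pow_aff:
  "Aff 0 u [^]\<^bsub>aff_group\<^esub> (i::int) = Aff 0 (of_int i * u)"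
  "Aff 1 0 [^]\<^bsub>aff_group\<^esub> (i::int) = Aff i 0"
proof -
  have 1: "Aff 0 u [^]\<^bsub>aff_group\<^esub> (k::nat) = Aff 0 (of_nat k * u)" for k
    by (induction k) (simp_all add: one_aff_def algebra_simps)
  have 2: "Aff 1 0 [^]\<^bsub>aff_group\<^esub> (k::nat) = Aff (int k) 0" for k
    by (induction k) (simp_all add: one_aff_def)
  show "Aff 0 u [^]\<^bsub>aff_group\<^esub> i = Aff 0 (of_int i * u)"
    by (cases i rule: int_cases2) (simp_all add: int_pow_int aff.int_pow_neg_int 1)
  show "Aff 1 0 [^]\<^bsub>aff_group\<^esub> i = Aff i 0"
    by (cases i rule: int_cases2) (simp_all add: int_pow_int aff.int_pow_neg_int 2)
qed

text \<open>
  The equation gives \<open>i\<^sup>2 + i j = j\<^sup>2\<close>, in which both integers are even: infinite descent.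
\<close>

lemma phi_irrational:
  assumes "of_int i + of_int j * phi = 0" shows "i = 0 \<and> j = 0"
proof -
  have descent: "i = 0 \<and> j = 0" if "i * i = i * j + j * j" for i j :: int
    using that
  proof (induction "nat (\<bar>i\<bar> + \<bar>j\<bar>)" arbitrary: i j rule: less_induct)
    case less
    have "even i \<and> even j"
      using less.prems by (metis even_add even_mult_iff)
    then obtain k l where kl: "i = 2 * k" "j = 2 * l" by (auto elim!: evenE)
    then have "k * k = k * l + l * l" using less.prems by simp
    moreover have "nat (\<bar>k\<bar> + \<bar>l\<bar>) < nat (\<bar>i\<bar> + \<bar>j\<bar>)" if "\<not> (k = 0 \<and> l = 0)"
    proof -
      have "0 < \<bar>k\<bar> + \<bar>l\<bar>" using that by linarith
      then show ?thesis unfolding kl abs_mult by simp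
    qed
    ultimately have "k = 0 \<and> l = 0" using less.hyps[of k l] by blast
    then show ?case by (simp add: kl)
  qed
  have "(- i) * (- i) = (- i) * j + j * j"
  proof -
    have i: "real_of_int (- i) = of_int j * phi" using assms by simp
    have "real_of_int ((- i) * (- i)) = of_int j * of_int j * (phi * phi)"
      unfolding of_int_mult i by simp
    also have "\<dots> = of_int ((- i) * j + j * j)"
      unfolding phi_square of_int_add of_int_mult i by (simp add: algebra_simps)
    finally show ?thesis by (simp only: of_int_eq_iff)
  qed
  from descent[OF this] show ?thesis by simp
qed

context group begin

text \<open>
  Used to move powers of one generator past another in the normal form.
\<close>

lemma int_pow_intertwine:
  assumes "x \<in> carrier G" "y \<in> carrier G" "z \<in> carrier G" and eq: "x \<otimes> y = z \<otimes> x"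
  shows "x \<otimes> y [^] (i::int) = z [^] i \<otimes> x"
proof -
  have nat: "x \<otimes> y [^] (k::nat) = z [^] k \<otimes> x" for k
  proof (induction k)
    case 0
    then show ?case using assms by simp
  next
    case (Suc k)
    have "x \<otimes> y [^] Suc k = (x \<otimes> y [^] k) \<otimes> y" using assms by (simp add: m_assoc)
    also have "\<dots> = z [^] k \<otimes> (x \<otimes> y)" using assms Suc by (simp add: m_assoc)
    also have "\<dots> = z [^] Suc k \<otimes> x" using assms by (simp add: m_assoc)
    finally show ?case .
  qed
  show ?thesis
  proof (cases i rule: int_cases2)
    case (nonneg k)
    then show ?thesis using nat by (simp add: int_pow_int)
  next
    case (nonpos k)
    have "inv (z [^] k) \<otimes> x = inv (z [^] k) \<otimes> ((x \<otimes> y [^] k) \<otimes> inv (y [^] k))"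
      using assms by (simp add: m_assoc)
    also have "\<dots> = (inv (z [^] k) \<otimes> z [^] k) \<otimes> (x \<otimes> inv (y [^] k))"
      unfolding nat[of k] using assms by (simp add: m_assoc[symmetric])
    also have "\<dots> = x \<otimes> inv (y [^] k)" using assms by simp
    finally have "x \<otimes> inv (y [^] k) = inv (z [^] k) \<otimes> x" by simp
    then show ?thesis using nonpos assms by (simp add: int_pow_neg_int)
  qed
qed

end

definition gen_a :: "gen word set" where "gen_a = pres_rel G_ab_relations `` {[(Gen_a, True)]}"
definition gen_b :: "gen word set" where "gen_b = pres_rel G_ab_relations `` {[(Gen_b, True)]}"

interpretation G_ab: group G_ab
  unfolding G_ab_def by (rule group_presented_group)

lemma gen_closed [simp]: "gen_a \<in> carrier G_ab" "gen_b \<in> carrier G_ab"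
  by (auto simp: gen_a_def gen_b_def G_ab_def carrier_presented_group)

lemma class_mult:
  "(pres_rel G_ab_relations `` {v}) \<otimes>\<^bsub>G_ab\<^esub> (pres_rel G_ab_relations `` {w}) =
   pres_rel G_ab_relations `` {v @ w}"
  by (simp add: G_ab_def mult_presented_group)

lemma inv_gen:
  "inv\<^bsub>G_ab\<^esub> gen_a = pres_rel G_ab_relations `` {[(Gen_a, False)]}"
  "inv\<^bsub>G_ab\<^esub> gen_b = pres_rel G_ab_relations `` {[(Gen_b, False)]}"
proof -
  have cancel: "pres_rel G_ab_relations `` {[(x, False), (x, True)]} = \<one>\<^bsub>G_ab\<^esub>" for x
    using pres_eq.cancel[of G_ab_relations "[]" x False "[]"]
    by (simp add: G_ab_def one_presented_group pres_class_eq_iff)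
  show "inv\<^bsub>G_ab\<^esub> gen_a = pres_rel G_ab_relations `` {[(Gen_a, False)]}"
    by (rule G_ab.inv_equality)
      (simp_all add: gen_a_def class_mult cancel, simp_all add: G_ab_def carrier_presented_group)
  show "inv\<^bsub>G_ab\<^esub> gen_b = pres_rel G_ab_relations `` {[(Gen_b, False)]}"
    by (rule G_ab.inv_equality)
      (simp_all add: gen_b_def class_mult cancel, simp_all add: G_ab_def carrier_presented_group)
qed

abbreviation "gen_ab \<equiv> group_conj G_ab gen_a gen_b"

lemma gen_ab_closed [simp]: "gen_ab \<in> carrier G_ab"
  by (simp add: group_conj_def)

lemma gen_ab_word:
  "gen_ab = pres_rel G_ab_relations `` {[(Gen_b, False), (Gen_a, True), (Gen_b, True)]}"
  unfolding group_conj_def inv_gen unfolding gen_a_def gen_b_def class_mult by simp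

lemma gen_relations:
  "gen_ab \<otimes>\<^bsub>G_ab\<^esub> gen_b = gen_b \<otimes>\<^bsub>G_ab\<^esub> (gen_a \<otimes>\<^bsub>G_ab\<^esub> gen_ab)"
  "gen_a \<otimes>\<^bsub>G_ab\<^esub> gen_ab = gen_ab \<otimes>\<^bsub>G_ab\<^esub> gen_a"
proof -
  have rel: "pres_rel G_ab_relations `` {l} = pres_rel G_ab_relations `` {r}"
    if "(l, r) \<in> G_ab_relations" for l r
    using pres_eq.relation[OF that, of "[]" "[]"] by (simp add: pres_class_eq_iff)
  have "pres_rel G_ab_relations `` {[(Gen_b, False), (Gen_b, False), (Gen_a, True), (Gen_b, True), (Gen_b, True)]} =
    pres_rel G_ab_relations `` {[(Gen_a, True), (Gen_b, False), (Gen_a, True), (Gen_b, True)]}"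
    by (rule rel) (simp add: G_ab_relations_def word_conj_def word_inv_def Let_def)
  then have "inv\<^bsub>G_ab\<^esub> gen_b \<otimes>\<^bsub>G_ab\<^esub> (gen_ab \<otimes>\<^bsub>G_ab\<^esub> gen_b) = gen_a \<otimes>\<^bsub>G_ab\<^esub> gen_ab"
    unfolding gen_ab_word inv_gen unfolding gen_a_def gen_b_def class_mult by simp
  then show "gen_ab \<otimes>\<^bsub>G_ab\<^esub> gen_b = gen_b \<otimes>\<^bsub>G_ab\<^esub> (gen_a \<otimes>\<^bsub>G_ab\<^esub> gen_ab)"
    by (metis G_ab.inv_solve_left G_ab.m_closed gen_ab_closed gen_closed)
  have "pres_rel G_ab_relations `` {[(Gen_a, True), (Gen_b, False), (Gen_a, True), (Gen_b, True)]} =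
    pres_rel G_ab_relations `` {[(Gen_b, False), (Gen_a, True), (Gen_b, True), (Gen_a, True)]}"
    by (rule rel) (simp add: G_ab_relations_def word_conj_def word_inv_def Let_def)
  then show "gen_a \<otimes>\<^bsub>G_ab\<^esub> gen_ab = gen_ab \<otimes>\<^bsub>G_ab\<^esub> gen_a"
    unfolding gen_ab_word unfolding gen_a_def class_mult by simp
qed

definition normal_form :: "int \<Rightarrow> int \<Rightarrow> int \<Rightarrow> gen word set" where
  "normal_form i j n =
     (gen_a [^]\<^bsub>G_ab\<^esub> i \<otimes>\<^bsub>G_ab\<^esub> gen_ab [^]\<^bsub>G_ab\<^esub> j) \<otimes>\<^bsub>G_ab\<^esub> gen_b [^]\<^bsub>G_ab\<^esub> n"

text \<open>
  With \<open>c = a\<^sup>b\<close>, the relations become the rules \<open>b c = a b\<close>, \<open>b a = c a\<^sup>-\<^sup>1 b\<close>, \<open>b\<^sup>-\<^sup>1 a = c b\<^sup>-\<^sup>1\<close>,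
  \<open>b\<^sup>-\<^sup>1 c = a c b\<^sup>-\<^sup>1\<close> that move a letter \<open>b\<close> or \<open>b\<^sup>-\<^sup>1\<close> from the left of a normal form to its place.
\<close>

lemma normal_form_step:
  assumes "x \<in> {gen_a, inv\<^bsub>G_ab\<^esub> gen_a, gen_b, inv\<^bsub>G_ab\<^esub> gen_b}"
  shows "\<exists>i' j' n'. x \<otimes>\<^bsub>G_ab\<^esub> normal_form i j n = normal_form i' j' n'"
proof -
  let ?mult = "(\<otimes>\<^bsub>G_ab\<^esub>)" and ?a = gen_a and ?b = gen_b and ?c = gen_ab
  have one: "x [^]\<^bsub>G_ab\<^esub> (1::int) = x" "x [^]\<^bsub>G_ab\<^esub> (- 1::int) = inv\<^bsub>G_ab\<^esub> x" if "x \<in> carrier G_ab" for x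
    using that G_ab.int_pow_neg[of x 1] by simp_all
  have add: "x [^]\<^bsub>G_ab\<^esub> k \<otimes>\<^bsub>G_ab\<^esub> (x [^]\<^bsub>G_ab\<^esub> l \<otimes>\<^bsub>G_ab\<^esub> y) = x [^]\<^bsub>G_ab\<^esub> (k + l) \<otimes>\<^bsub>G_ab\<^esub> y"
    if "x \<in> carrier G_ab" "y \<in> carrier G_ab" for x y and k l :: int
    using that by (simp add: G_ab.m_assoc[symmetric] G_ab.int_pow_mult)
  have comm: "?mult (?c [^]\<^bsub>G_ab\<^esub> k) (?a [^]\<^bsub>G_ab\<^esub> l) = ?mult (?a [^]\<^bsub>G_ab\<^esub> l) (?c [^]\<^bsub>G_ab\<^esub> k)" for k l :: int
    using G_ab.int_pow_intertwine[of "?a [^]\<^bsub>G_ab\<^esub> l" ?c ?c k]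
      G_ab.int_pow_intertwine[of ?c ?a ?a l] gen_relations(2) by simp
  consider "x = ?a" | "x = inv\<^bsub>G_ab\<^esub> ?a" | "x = ?b" | "x = inv\<^bsub>G_ab\<^esub> ?b" using assms by blast
  then show ?thesis
  proof cases
    case 1
    then have "?mult x (normal_form i j n) = normal_form (1 + i) j n"
      using add[of ?a _ 1 i] one[of ?a] by (simp add: normal_form_def G_ab.m_assoc)
    then show ?thesis by blast
  next
    case 2
    then have "?mult x (normal_form i j n) = normal_form (- 1 + i) j n"
      using add[of ?a _ "- 1" i] one[of ?a] by (simp add: normal_form_def G_ab.m_assoc)
    then show ?thesis by blast
  next
    case 3
    have c: "?c [^]\<^bsub>G_ab\<^esub> j \<in> carrier G_ab" "?a [^]\<^bsub>G_ab\<^esub> i \<in> carrier G_ab" "?b [^]\<^bsub>G_ab\<^esub> n \<in> carrier G_ab"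
      by simp_all
    have bc: "?mult ?b ?c = ?mult ?a ?b"
      unfolding group_conj_def by (simp add: G_ab.m_assoc[symmetric])
    have "?mult (?mult (?mult ?c (inv\<^bsub>G_ab\<^esub> ?a)) ?b) ?c = ?mult ?c ?b"
      by (simp add: G_ab.m_assoc bc) (simp add: G_ab.m_assoc[symmetric])
    also have "\<dots> = ?mult (?mult ?b ?a) ?c"
      using gen_relations(1) by (simp add: G_ab.m_assoc)
    finally have ba: "?mult ?b ?a = ?mult (?mult ?c (inv\<^bsub>G_ab\<^esub> ?a)) ?b"
      by simp
    have bn: "?mult ?b (?b [^]\<^bsub>G_ab\<^esub> n) = ?b [^]\<^bsub>G_ab\<^esub> (1 + n)"
      using G_ab.int_pow_mult[of ?b 1 n] one[of ?b] by (metis gen_closed(2))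
    have ci: "?mult ?c (inv\<^bsub>G_ab\<^esub> ?a) = ?mult (inv\<^bsub>G_ab\<^esub> ?a) ?c"
      using comm[of 1 "- 1"] one by simp
    have p: "(?mult ?c (inv\<^bsub>G_ab\<^esub> ?a)) [^]\<^bsub>G_ab\<^esub> i = ?mult (?a [^]\<^bsub>G_ab\<^esub> (- i)) (?c [^]\<^bsub>G_ab\<^esub> i)"
      unfolding ci
      by (subst G_ab.int_pow_mult_distrib) (simp_all add: ci G_ab.int_pow_inv G_ab.int_pow_neg)
    have "?mult ?b (?mult (?mult (?a [^]\<^bsub>G_ab\<^esub> i) (?c [^]\<^bsub>G_ab\<^esub> j)) (?b [^]\<^bsub>G_ab\<^esub> n)) =
       ?mult (?mult ?b (?a [^]\<^bsub>G_ab\<^esub> i)) (?mult (?c [^]\<^bsub>G_ab\<^esub> j) (?b [^]\<^bsub>G_ab\<^esub> n))"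
      using c by (simp add: G_ab.m_assoc)
    also have "\<dots> = ?mult (?mult (?a [^]\<^bsub>G_ab\<^esub> (- i)) (?c [^]\<^bsub>G_ab\<^esub> i))
        (?mult (?mult ?b (?c [^]\<^bsub>G_ab\<^esub> j)) (?b [^]\<^bsub>G_ab\<^esub> n))"
      using G_ab.int_pow_intertwine[OF _ _ _ ba, of i] p by (simp add: G_ab.m_assoc)
    also have "\<dots> = ?mult (?a [^]\<^bsub>G_ab\<^esub> (- i)) (?mult (?mult (?c [^]\<^bsub>G_ab\<^esub> i) (?a [^]\<^bsub>G_ab\<^esub> j))
        (?mult ?b (?b [^]\<^bsub>G_ab\<^esub> n)))"
      using G_ab.int_pow_intertwine[OF _ _ _ bc, of j] by (simp add: G_ab.m_assoc)
    also have "\<dots> = normal_form (- i + j) i (1 + n)"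
      unfolding comm using add[of ?a _ "- i" j] bn
      by (simp add: normal_form_def G_ab.m_assoc)
    finally show ?thesis using 3 unfolding normal_form_def by blast
  next
    case 4
    let ?B = "inv\<^bsub>G_ab\<^esub> ?b"
    have Ba: "?mult ?B ?a = ?mult ?c ?B"
      unfolding group_conj_def by (simp add: G_ab.m_assoc)
    have "?mult ?B (?mult ?c ?b) = ?mult ?a ?c"
      unfolding gen_relations(1) by (simp add: G_ab.m_assoc[symmetric])
    then have "?mult (?mult ?a ?c) ?B = ?mult (?mult ?B (?mult ?c ?b)) ?B" by simp
    then have Bc: "?mult ?B ?c = ?mult (?mult ?a ?c) ?B"
      by (simp add: G_ab.m_assoc)
    have Bn: "?mult ?B (?b [^]\<^bsub>G_ab\<^esub> n) = ?b [^]\<^bsub>G_ab\<^esub> (- 1 + n)"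
      using G_ab.int_pow_mult[of ?b "- 1" n] one[of ?b] by (metis gen_closed(2))
    have p: "(?mult ?a ?c) [^]\<^bsub>G_ab\<^esub> j = ?mult (?a [^]\<^bsub>G_ab\<^esub> j) (?c [^]\<^bsub>G_ab\<^esub> j)"
      by (rule G_ab.int_pow_mult_distrib) (simp_all add: gen_relations(2))
    have "?mult ?B (?mult (?mult (?a [^]\<^bsub>G_ab\<^esub> i) (?c [^]\<^bsub>G_ab\<^esub> j)) (?b [^]\<^bsub>G_ab\<^esub> n)) =
       ?mult (?mult ?B (?a [^]\<^bsub>G_ab\<^esub> i)) (?mult (?c [^]\<^bsub>G_ab\<^esub> j) (?b [^]\<^bsub>G_ab\<^esub> n))"
      by (simp add: G_ab.m_assoc)
    also have "\<dots> = ?mult (?c [^]\<^bsub>G_ab\<^esub> i) (?mult (?mult ?B (?c [^]\<^bsub>G_ab\<^esub> j)) (?b [^]\<^bsub>G_ab\<^esub> n))"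
      using G_ab.int_pow_intertwine[OF _ _ _ Ba, of i] by (simp add: G_ab.m_assoc)
    also have "\<dots> = ?mult (?mult (?c [^]\<^bsub>G_ab\<^esub> i) (?a [^]\<^bsub>G_ab\<^esub> j)) (?mult (?c [^]\<^bsub>G_ab\<^esub> j)
        (?mult ?B (?b [^]\<^bsub>G_ab\<^esub> n)))"
      using G_ab.int_pow_intertwine[OF _ _ _ Bc, of j] p by (simp add: G_ab.m_assoc)
    also have "\<dots> = normal_form j (i + j) (- 1 + n)"
      unfolding comm using add[of ?c _ i j] Bn
      by (simp add: normal_form_def G_ab.m_assoc)
    finally show ?thesis using 4 unfolding normal_form_def by blast
  qed
qed

lemma normal_form_exists:
  assumes "x \<in> carrier G_ab"
  shows "\<exists>i j n. x = normal_form i j n"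
proof -
  have "\<exists>i j n. pres_rel G_ab_relations `` {w} = normal_form i j n" for w
  proof (induction w)
    case Nil
    have "pres_rel G_ab_relations `` {[]} = normal_form 0 0 0"
      by (simp add: normal_form_def) (simp add: G_ab_def one_presented_group)
    then show ?case by blast
  next
    case (Cons l w)
    have "pres_rel G_ab_relations `` {[l]} \<in> {gen_a, inv\<^bsub>G_ab\<^esub> gen_a, gen_b, inv\<^bsub>G_ab\<^esub> gen_b}"
    proof -
      obtain x e where "l = (x, e)" by fastforce
      then show ?thesis
        unfolding inv_gen unfolding gen_a_def gen_b_def by (cases x; cases e) simp_all
    qed
    moreover have "pres_rel G_ab_relations `` {l # w} =
        (pres_rel G_ab_relations `` {[l]}) \<otimes>\<^bsub>G_ab\<^esub> (pres_rel G_ab_relations `` {w})"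
      by (simp add: class_mult)
    ultimately show ?case using Cons normal_form_step by metis
  qed
  then show ?thesis using assms by (auto simp: G_ab_def carrier_presented_group)
qed

text \<open>
  The relations hold for \<open>(0, 1)\<close> and \<open>(1, 0)\<close> because \<open>\<phi>\<^sup>2 = \<phi> + 1\<close>. The normal form with exponents
  \<open>i, j, n\<close> goes to \<open>(n, \<phi>\<^sup>n (i + j \<phi>))\<close>, which is trivial only if all three vanish.
\<close>

theorem G_ab_embedding:
  "\<exists>h \<in> hom G_ab aff_group. inj_on h (carrier G_ab) \<and> h gen_a = Aff 0 1 \<and> h gen_b = Aff 1 0"
proof -
  define f where "f x = (case x of Gen_a \<Rightarrow> Aff 0 1 | Gen_b \<Rightarrow> Aff 1 0)" for x
  have "eval_word aff_group f l = eval_word aff_group f r" if "(l, r) \<in> G_ab_relations" for l r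
    using that phi_square
    by (auto simp: G_ab_relations_def Let_def word_conj_def word_inv_def f_def one_aff_def power_int_minus
       algebra_simps power2_eq_square)
  then obtain h where h: "h \<in> hom G_ab aff_group"
    and eval: "\<And>w. h (pres_rel G_ab_relations `` {w}) = eval_word aff_group f w"
    using aff.presented_group_universal[of f G_ab_relations] unfolding G_ab_def by auto
  have gens: "h gen_a = Aff 0 1" "h gen_b = Aff 1 0"
    by (simp_all add: gen_a_def gen_b_def eval f_def one_aff_def)
  interpret h: group_hom G_ab aff_group h
    using h by unfold_locales
  have "h gen_ab = Aff 0 phi"
    by (simp add: group_conj_def gens)
  then have nf: "h (normal_form i j n) = Aff n (phi powi n * (of_int i + of_int j * phi))" for i j n
    by (simp add: normal_form_def h.hom_int_pow gens int_pow_aff algebra_simps)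
  have "inj_on h (carrier G_ab)"
  proof (subst h.inj_on_one_iff, intro allI impI)
    fix x assume x: "x \<in> carrier G_ab" "h x = \<one>\<^bsub>aff_group\<^esub>"
    obtain i j n where ijn: "x = normal_form i j n" using normal_form_exists x(1) by blast
    then have "n = 0" "of_int i + of_int j * phi = 0"
      using x(2) nf[of i j n] by (simp_all add: one_aff_def)
    then show "x = \<one>\<^bsub>G_ab\<^esub>" using phi_irrational[of i j] ijn by (simp add: normal_form_def)
  qed
  with h gens show ?thesis by blast
qed

section \<open>Transfer to the presented group\<close>

context group begin

lemma subgroup_centralizer:
  assumes "Y \<subseteq> carrier G"
  shows "subgroup {x \<in> carrier G. \<forall>y\<in>Y. x \<otimes> y = y \<otimes> x} G"
proof (rule subgroupI)
  fix x assume x: "x \<in> {x \<in> carrier G. \<forall>y\<in>Y. x \<otimes> y = y \<otimes> x}"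
  have "inv x \<otimes> y = y \<otimes> inv x" if "y \<in> Y" for y
  proof -
    have y: "y \<in> carrier G" "x \<otimes> y = y \<otimes> x" and x': "x \<in> carrier G"
      using x that assms by blast+
    have "y \<otimes> inv x = inv x \<otimes> (x \<otimes> y) \<otimes> inv x" using x' y(1) by (simp add: m_assoc[symmetric])
    also have "\<dots> = inv x \<otimes> (y \<otimes> x) \<otimes> inv x" by (simp only: y(2))
    also have "\<dots> = inv x \<otimes> y" using x' y(1) by (simp add: m_assoc)
    finally show ?thesis by simp
  qed
  then show "inv x \<in> {x \<in> carrier G. \<forall>y\<in>Y. x \<otimes> y = y \<otimes> x}" using x by blast
next
  fix x z assume x: "x \<in> {x \<in> carrier G. \<forall>y\<in>Y. x \<otimes> y = y \<otimes> x}"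
    and z: "z \<in> {x \<in> carrier G. \<forall>y\<in>Y. x \<otimes> y = y \<otimes> x}"
  have "x \<otimes> z \<otimes> y = y \<otimes> (x \<otimes> z)" if "y \<in> Y" for y
  proof -
    have c: "x \<in> carrier G" "y \<in> carrier G" "z \<in> carrier G"
      and xy: "x \<otimes> y = y \<otimes> x" and zy: "z \<otimes> y = y \<otimes> z"
      using x z that assms by blast+
    have "x \<otimes> z \<otimes> y = (x \<otimes> y) \<otimes> z" using c by (simp add: m_assoc zy)
    also have "\<dots> = y \<otimes> (x \<otimes> z)" unfolding xy using c by (simp add: m_assoc)
    finally show ?thesis .
  qed
  then show "x \<otimes> z \<in> {x \<in> carrier G. \<forall>y\<in>Y. x \<otimes> y = y \<otimes> x}" using x z by blast
qed (use assms in \<open>auto intro!: exI[of _ \<one>]\<close>)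

text \<open>
  The elements commuting with \<open>S\<close> form a subgroup containing \<open>S\<close>, hence the generated subgroup. So do
  the elements commuting with that subgroup.
\<close>

lemma generate_commute:
  assumes S: "S \<subseteq> carrier G" and comm: "\<And>x y. x \<in> S \<Longrightarrow> y \<in> S \<Longrightarrow> x \<otimes> y = y \<otimes> x"
    and x: "x \<in> generate G S" and y: "y \<in> generate G S"
  shows "x \<otimes> y = y \<otimes> x"
proof -
  have 1: "u \<otimes> s = s \<otimes> u" if "u \<in> generate G S" "s \<in> S" for u s
    using generate_subgroup_incl[OF _ subgroup_centralizer[OF S], of S] S comm that by blast
  have closed: "generate G S \<subseteq> carrier G" using S by (rule generate_incl)
  have "S \<subseteq> {x \<in> carrier G. \<forall>y\<in>generate G S. x \<otimes> y = y \<otimes> x}"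
    using S 1 by (force intro: sym)
  then have "generate G S \<subseteq> {x \<in> carrier G. \<forall>y\<in>generate G S. x \<otimes> y = y \<otimes> x}"
    by (rule generate_subgroup_incl[OF _ subgroup_centralizer[OF closed]])
  then show ?thesis using x y by blast
qed

end

lemma ordered_group_pullback:
  assumes "group G" "h \<in> hom G aff_group" "inj_on h (carrier G)"
  shows "ordered_group G {(x, y). x \<in> carrier G \<and> y \<in> carrier G \<and> h x \<le> h y}" (is "ordered_group G ?le")
proof -
  interpret group G by fact
  have mult: "h (x \<otimes>\<^bsub>G\<^esub> y) = h x * h y" if "x \<in> carrier G" "y \<in> carrier G" for x y
    using assms(2) that by (simp add: hom_def)
  show ?thesis
  proof
    show "linear_order_on (carrier G) ?le"
      using assms(3)
      by (auto simp: linear_order_on_def partial_order_on_def preorder_on_def refl_on_def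
          trans_def antisym_def total_on_def inj_on_def)
  next
    fix a b x y assume "(a, b) \<in> ?le" "x \<in> carrier G" "y \<in> carrier G"
    then show "(x \<otimes>\<^bsub>G\<^esub> a \<otimes>\<^bsub>G\<^esub> y, x \<otimes>\<^bsub>G\<^esub> b \<otimes>\<^bsub>G\<^esub> y) \<in> ?le" by (simp add: mult)
  qed
qed

lemma (in ordered_group) inverse_gt_one:
  assumes "c \<in> carrier G" "(\<one>, c) \<notin> le"
  shows "(\<one>, inv c) \<in> le"
proof -
  have "refl_on (carrier G) le" "total_on (carrier G) le"
    using linear_order by (auto simp: linear_order_on_def partial_order_on_def preorder_on_def)
  then have "(c, \<one>) \<in> le"
    using assms one_closed unfolding refl_on_def total_on_def by metis
  from mult_mono[OF this, of "inv c" \<one>] assms(1) show ?thesis by simp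
qed

text \<open>
  The image of \<open>S\<close> is nonabelian since otherwise \<open>S\<close> would generate an abelian group, while the images
  of the two generators do not commute.
\<close>

theorem generating_set_golden_image:
  assumes h: "h \<in> hom G_ab aff_group" "inj_on h (carrier G_ab)"
    and gens: "h gen_a = Aff 0 1" "h gen_b = Aff 1 0"
    and S: "finite S" "S \<subseteq> carrier G_ab" "generate G_ab S = carrier G_ab"
    and few: "card (S <#>\<^bsub>G_ab\<^esub> S) \<le> 3 * card S - 2" and card: "4 \<le> card S"
  shows "card S = 4 \<and> (\<exists>n t r. (n = 1 \<or> n = - 1) \<and> r \<noteq> 0 \<and>
      h ` S = {Aff n t, Aff n (t + r), Aff n (t + phi * r), Aff n (t + phi * phi * r)})"
proof -
  have mult: "h (x \<otimes>\<^bsub>G_ab\<^esub> y) = h x * h y" if "x \<in> carrier G_ab" "y \<in> carrier G_ab" for x y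
    using h(1) that by (simp add: hom_def)
  have inj: "inj_on h S" using h(2) S(2) by (rule inj_on_subset)
  have "sq (h ` S) = h ` (S <#>\<^bsub>G_ab\<^esub> S)"
  proof -
    have eq: "h x * h y = h (x \<otimes>\<^bsub>G_ab\<^esub> y)" if "x \<in> S" "y \<in> S" for x y
    proof -
      have "x \<in> carrier G_ab" "y \<in> carrier G_ab" using S(2) that by blast+
      then show ?thesis by (rule mult[symmetric])
    qed
    show ?thesis
    proof (intro equalityI subsetI)
      fix z assume "z \<in> sq (h ` S)"
      then obtain x y where "x \<in> S" "y \<in> S" "z = h x * h y" by (auto elim!: sqE)
      then show "z \<in> h ` (S <#>\<^bsub>G_ab\<^esub> S)" unfolding set_mult_def by (auto simp: eq)
    next
      fix z assume "z \<in> h ` (S <#>\<^bsub>G_ab\<^esub> S)"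
      then obtain x y where xy: "x \<in> S" "y \<in> S" "z = h (x \<otimes>\<^bsub>G_ab\<^esub> y)"
        unfolding set_mult_def by blast
      then have "z = h x * h y" by (simp add: eq)
      then show "z \<in> sq (h ` S)" using xy by (simp add: sqI)
    qed
  qed
  moreover have "S <#>\<^bsub>G_ab\<^esub> S \<subseteq> carrier G_ab"
    using S(2) by (rule G_ab.set_mult_closed[OF _ S(2)])
  then have "card (h ` (S <#>\<^bsub>G_ab\<^esub> S)) = card (S <#>\<^bsub>G_ab\<^esub> S)"
    using h(2) by (meson card_image inj_on_subset)
  ultimately have few': "card (sq (h ` S)) \<le> 3 * card (h ` S) - 2"
    using few card_image[OF inj] by simp
  have "\<not> abelian_set (h ` S)"
  proof
    assume "abelian_set (h ` S)"
    then have "h (x \<otimes>\<^bsub>G_ab\<^esub> y) = h (y \<otimes>\<^bsub>G_ab\<^esub> x)" if "x \<in> S" "y \<in> S" for x y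
    proof -
      have "x \<in> carrier G_ab" "y \<in> carrier G_ab" using S(2) that by blast+
      moreover have "h x * h y = h y * h x"
        using \<open>abelian_set (h ` S)\<close> that by (auto simp: abelian_set_def)
      ultimately show ?thesis by (simp add: mult)
    qed
    then have "x \<otimes>\<^bsub>G_ab\<^esub> y = y \<otimes>\<^bsub>G_ab\<^esub> x" if "x \<in> S" "y \<in> S" for x y
      using h(2) S(2) that by (meson G_ab.m_closed inj_onD subsetD)
    then have "gen_a \<otimes>\<^bsub>G_ab\<^esub> gen_b = gen_b \<otimes>\<^bsub>G_ab\<^esub> gen_a"
      by (rule G_ab.generate_commute[OF S(2)]) (simp_all add: S(3))
    then have "h gen_a * h gen_b = h gen_b * h gen_a" using mult by (metis gen_closed)
    then show False using phi_bounds by (simp add: gens)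
  qed
  then show ?thesis
    using small_square_imp_golden[of "h ` S"] S(1) card few' card_image[OF inj] by simp
qed

text \<open>
  The element \<open>c\<close> is the preimage of \<open>(0, r)\<close>, or of \<open>(0, - r)\<close> if the former is negative in the given
  order. An element \<open>x\<close> with first component \<open>1\<close> acts on it by multiplication with \<open>\<phi>\<close>, so the required
  relations reduce to \<open>\<phi>\<^sup>2 = \<phi> + 1\<close>.
\<close>

theorem golden_image_solution:
  fixes le
  assumes h: "h \<in> hom G_ab aff_group" "inj_on h (carrier G_ab)"
    and le: "ordered_group G_ab le" and S: "S \<subseteq> carrier G_ab"
    and n: "n = 1 \<or> n = - 1" and "r \<noteq> 0"
    and hS: "h ` S = {Aff n t, Aff n (t + r), Aff n (t + phi * r), Aff n (t + phi * phi * r)}"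
  shows "\<exists>x\<in>carrier G_ab. \<exists>c\<in>carrier G_ab.
            (\<one>\<^bsub>G_ab\<^esub>, c) \<in> le \<and> c \<noteq> \<one>\<^bsub>G_ab\<^esub> \<and>
            group_conj G_ab c (x [^]\<^bsub>G_ab\<^esub> (2::nat)) = c \<otimes>\<^bsub>G_ab\<^esub> group_conj G_ab c x \<and>
            c \<otimes>\<^bsub>G_ab\<^esub> group_conj G_ab c x = group_conj G_ab c x \<otimes>\<^bsub>G_ab\<^esub> c \<and>
            (S = {x, x \<otimes>\<^bsub>G_ab\<^esub> c, x \<otimes>\<^bsub>G_ab\<^esub> group_conj G_ab c x,
                  x \<otimes>\<^bsub>G_ab\<^esub> group_conj G_ab c (x [^]\<^bsub>G_ab\<^esub> (2::nat))} \<or>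
             S = {inv\<^bsub>G_ab\<^esub> x, inv\<^bsub>G_ab\<^esub> x \<otimes>\<^bsub>G_ab\<^esub> c, inv\<^bsub>G_ab\<^esub> x \<otimes>\<^bsub>G_ab\<^esub> group_conj G_ab c x,
                  inv\<^bsub>G_ab\<^esub> x \<otimes>\<^bsub>G_ab\<^esub> group_conj G_ab c (x [^]\<^bsub>G_ab\<^esub> (2::nat))})"
proof -
  interpret ordered_group G_ab le by fact
  interpret h: group_hom G_ab aff_group h using h(1) by unfold_locales
  note inj = inj_onD[OF h(2)]
  have pick: "\<exists>y\<in>carrier G_ab. h y = w" if "w \<in> h ` S" for w using that S by auto
  have "\<exists>y\<in>carrier G_ab. \<exists>c\<in>carrier G_ab. \<exists>u q. (\<one>\<^bsub>G_ab\<^esub>, c) \<in> le \<and> q \<noteq> 0 \<and>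
    h y = Aff n u \<and> h c = Aff 0 q \<and>
    h ` S = {Aff n u, Aff n (u + q), Aff n (u + phi * q), Aff n (u + phi * phi * q)}"
  proof -
    obtain y z y' where y: "y \<in> carrier G_ab" "h y = Aff n t" and z: "z \<in> carrier G_ab" "h z = Aff n (t + r)"
      and y': "y' \<in> carrier G_ab" "h y' = Aff n (t + phi * phi * r)"
      using pick unfolding hS by (metis insertCI)
    \<comment> \<open>The quotient of the first two elements maps to the step \<open>(0, r)\<close>.\<close>
    define c where "c = inv\<^bsub>G_ab\<^esub> y \<otimes>\<^bsub>G_ab\<^esub> z"
    have c: "c \<in> carrier G_ab" "h c = Aff 0 r"
      using y z by (simp_all add: c_def power_int_minus)
    show ?thesis
    proof (cases "(\<one>\<^bsub>G_ab\<^esub>, c) \<in> le")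
      case True
      then show ?thesis using c y hS \<open>r \<noteq> 0\<close> by blast
    next
      case False
      then have pos: "(\<one>\<^bsub>G_ab\<^esub>, inv\<^bsub>G_ab\<^esub> c) \<in> le" using c(1) by (intro inverse_gt_one)
      have hc: "h (inv\<^bsub>G_ab\<^esub> c) = Aff 0 (- r)" using c by simp
      \<comment> \<open>Read from the other end with step \<open>- r\<close>: this uses \<open>\<phi>\<^sup>2 - 1 = \<phi>\<close> and \<open>\<phi>\<^sup>2 - \<phi> = 1\<close>.\<close>
      have hS_rev: "h ` S = {Aff n (t + phi * phi * r), Aff n (t + phi * phi * r + - r),
          Aff n (t + phi * phi * r + phi * - r), Aff n (t + phi * phi * r + phi * phi * - r)}"
        unfolding hS phi_square by (auto simp: algebra_simps)
      have "inv\<^bsub>G_ab\<^esub> c \<in> carrier G_ab" using c(1) by simp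
      moreover have "- r \<noteq> 0" using \<open>r \<noteq> 0\<close> by simp
      ultimately show ?thesis using pos hc hS_rev y' by blast
    qed
  qed
  then obtain y c u q where y: "y \<in> carrier G_ab" "h y = Aff n u"
    and c: "c \<in> carrier G_ab" "h c = Aff 0 q" "(\<one>\<^bsub>G_ab\<^esub>, c) \<in> le" and "q \<noteq> 0"
    and hS': "h ` S = {Aff n u, Aff n (u + q), Aff n (u + phi * q), Aff n (u + phi * phi * q)}"
    by blast
  \<comment> \<open>The two alternatives of the conclusion are the two cosets: \<open>x\<close> always has first component \<open>1\<close>.\<close>
  define x where "x = (if n = 1 then y else inv\<^bsub>G_ab\<^esub> y)"
  have x: "x \<in> carrier G_ab" using y by (simp add: x_def)
  obtain v where hx: "h x = Aff 1 v" using y n by (auto simp: x_def)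
  have closed: "group_conj G_ab c w \<in> carrier G_ab" if "w \<in> carrier G_ab" for w
    using that c by (simp add: group_conj_def)
  have cx: "h (group_conj G_ab c x) = Aff 0 (phi * q)"
    using x c hx by (simp add: group_conj_def power_int_minus algebra_simps)
  have cxx: "h (group_conj G_ab c (x [^]\<^bsub>G_ab\<^esub> (2::nat))) = Aff 0 (phi * phi * q)"
    using x c hx by (simp add: group_conj_def numeral_2_eq_2 power_int_minus algebra_simps)
  have "c \<noteq> \<one>\<^bsub>G_ab\<^esub>" using c(2) \<open>q \<noteq> 0\<close> h.hom_one by (auto simp: one_aff_def)
  moreover have "group_conj G_ab c (x [^]\<^bsub>G_ab\<^esub> (2::nat)) = c \<otimes>\<^bsub>G_ab\<^esub> group_conj G_ab c x"
    by (rule inj) (use cx cxx c x closed phi_square in \<open>simp_all add: algebra_simps\<close>)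
  moreover have "c \<otimes>\<^bsub>G_ab\<^esub> group_conj G_ab c x = group_conj G_ab c x \<otimes>\<^bsub>G_ab\<^esub> c"
    by (rule inj) (use cx c x closed in simp_all)
  moreover have "S = {y, y \<otimes>\<^bsub>G_ab\<^esub> c, y \<otimes>\<^bsub>G_ab\<^esub> group_conj G_ab c x,
      y \<otimes>\<^bsub>G_ab\<^esub> group_conj G_ab c (x [^]\<^bsub>G_ab\<^esub> (2::nat))}" (is "S = ?R")
  proof -
    have "?R \<subseteq> carrier G_ab" using x y c closed by simp
    moreover have "h ` ?R = h ` S"
      using x y c closed by (simp add: hS' cx cxx)
    ultimately show ?thesis using h(2) S by (metis inj_on_image_eq_iff)
  qed
  moreover have "y = x \<or> y = inv\<^bsub>G_ab\<^esub> x" using y by (simp add: x_def)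
  ultimately show ?thesis using x c by blast
qed

theorem theorem2:
  shows "orderable G_ab \<and>
    (\<forall>le. ordered_group G_ab le \<longrightarrow>
      (\<forall>S. finite S \<and> S \<subseteq> carrier G_ab \<and> generate G_ab S = carrier G_ab \<and>
           int (card (S <#>\<^bsub>G_ab\<^esub> S)) = 3 * int (card S) - 2 \<longrightarrow>
         card S \<le> 4) \<and>
      (\<forall>S. finite S \<and> S \<subseteq> carrier G_ab \<and> generate G_ab S = carrier G_ab \<and>
           int (card (S <#>\<^bsub>G_ab\<^esub> S)) = 3 * int (card S) - 2 \<and> card S = 4 \<longrightarrow>
         (\<exists>x\<in>carrier G_ab. \<exists>c\<in>carrier G_ab.
            (\<one>\<^bsub>G_ab\<^esub>, c) \<in> le \<and> c \<noteq> \<one>\<^bsub>G_ab\<^esub> \<and>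
            group_conj G_ab c (x [^]\<^bsub>G_ab\<^esub> (2::nat)) = c \<otimes>\<^bsub>G_ab\<^esub> group_conj G_ab c x \<and>
            c \<otimes>\<^bsub>G_ab\<^esub> group_conj G_ab c x = group_conj G_ab c x \<otimes>\<^bsub>G_ab\<^esub> c \<and>
            (S = {x, x \<otimes>\<^bsub>G_ab\<^esub> c, x \<otimes>\<^bsub>G_ab\<^esub> group_conj G_ab c x,
                  x \<otimes>\<^bsub>G_ab\<^esub> group_conj G_ab c (x [^]\<^bsub>G_ab\<^esub> (2::nat))} \<or>
             S = {inv\<^bsub>G_ab\<^esub> x, inv\<^bsub>G_ab\<^esub> x \<otimes>\<^bsub>G_ab\<^esub> c, inv\<^bsub>G_ab\<^esub> x \<otimes>\<^bsub>G_ab\<^esub> group_conj G_ab c x,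
                  inv\<^bsub>G_ab\<^esub> x \<otimes>\<^bsub>G_ab\<^esub> group_conj G_ab c (x [^]\<^bsub>G_ab\<^esub> (2::nat))}))))"
proof -
  obtain h where h: "h \<in> hom G_ab aff_group" "inj_on h (carrier G_ab)"
    "h gen_a = Aff 0 1" "h gen_b = Aff 1 0"
    using G_ab_embedding by blast
  have transfer: "card S = 4 \<and> (\<exists>n t r. (n = 1 \<or> n = - 1) \<and> r \<noteq> 0 \<and>
      h ` S = {Aff n t, Aff n (t + r), Aff n (t + phi * r), Aff n (t + phi * phi * r)})"
    if "finite S" "S \<subseteq> carrier G_ab" "generate G_ab S = carrier G_ab"
      "int (card (S <#>\<^bsub>G_ab\<^esub> S)) = 3 * int (card S) - 2" "4 \<le> card S" for S
  proof -
    have "card (S <#>\<^bsub>G_ab\<^esub> S) \<le> 3 * card S - 2" using that(4) by linarith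
    then show ?thesis using generating_set_golden_image[OF h that(1-3) _ that(5)] by blast
  qed
  show ?thesis
  proof (intro conjI allI impI, goal_cases)
    case 1
    show ?case
      unfolding orderable_def using ordered_group_pullback[OF G_ab.group_axioms h(1,2)] by blast
  next
    case (2 le S)
    show ?case
    proof (rule ccontr)
      assume large: "\<not> card S \<le> 4"
      then have "4 \<le> card S" by simp
      with 2 have "card S = 4" using transfer[of S] by blast
      with large show False by simp
    qed
  next
    case (3 le S)
    then have "card S = 4 \<and> (\<exists>n t r. (n = 1 \<or> n = - 1) \<and> r \<noteq> 0 \<and>
      h ` S = {Aff n t, Aff n (t + r), Aff n (t + phi * r), Aff n (t + phi * phi * r)})"
      by (intro transfer) simp_all
    then obtain n t r where nr: "n = 1 \<or> n = - 1" "r \<noteq> 0" and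
      hS: "h ` S = {Aff n t, Aff n (t + r), Aff n (t + phi * r), Aff n (t + phi * phi * r)}"
      by blast
    have "S \<subseteq> carrier G_ab" using 3 by simp
    from golden_image_solution[OF h(1,2) 3(1) this nr hS] show ?case .
  qed
qed

end
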